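(* Let $T>0$, let $\varphi:\mathbb{R}\to\mathbb{R}$ be a homeomorphism with $\varphi(0)=0$, let $b=1$, and let $f:[0,T]\times\mathbb{R}\times\mathbb{R}\to\mathbb{R}$ be continuous. Suppose that: (i) there exists $c\in C$ such that $f(t,x,y)\ge c(t)$ for all $(t,x,y)\in[0,T]\times\mathbb{R}\times\mathbb{R}$; (ii) there exist $M_1<M_2$ such that for all $u\in C^1$, $$\int_0^T f(t,u(t),u'(t))\,dt\neq 0\ \text{ if } \min_{[0,T]}u'\ge M_2,\qquad \int_0^T f(t,u(t),u'(t))\,dt\neq 0\ \text{ if } \max_{[0,T]}u'\le M_1.$$ Let $L=\max\{|\varphi(M_2)|,|\varphi(M_1)|\}$ and $$r=\max\left\{|\varphi^{-1}(L+2\|c^-\|_{L^1})|,\ |\varphi^{-1}(-L-2\|c^-\|_{L^1})|\right\}.$$ Assume that the following conditions hold for some $\rho\ge r(2+T)$: 1. the equation $G(x,y)=(0,0)$ has no solution on $\partial B_\rho(0)\cap\mathbb{R}^2$, where $\mathbb{R}^2$ is identified with the affine functions in $C^1$ via $(x,y)\approx x+yt$; 2. the Brouwer degree satisfies $\deg_B(G,B_\rho(0)\cap\mathbb{R}^2,0)\neq 0$. Then the problem $$(\varphi(u'))'=f(t,u,u'),\quad u'(0)=u(0),\quad u'(T)=u'(0)$$ has a solution.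
   Context: $C=C([0,T],\mathbb{R})$ carries the norm $\|\cdot\|_\infty$, and $C^1=C^1([0,T],\mathbb{R})$ carries the norm $\|u\|_1=\|u\|_\infty+\|u'\|_\infty$; $\|\cdot\|_{L^1}$ is the usual norm of $L^1([0,T],\mathbb{R})$, and $c^-=\max\{-c,0\}$. A solution is a function $u\in C^1$ such that $\varphi(u')$ is continuously differentiable, $(\varphi(u'(t)))'=f(t,u(t),u'(t))$ for all $t\in[0,T]$, and the boundary conditions hold. $B_{\varphi,b}(x)=\varphi(bx)-\varphi(x)$ for $x\in\mathbb{R}$ (so it is identically $0$ for $b=1$). The map $G:\mathbb{R}^2\to\mathbb{R}^2$ is $$G(x,y)=\left(\frac{B_{\varphi,b}(x)}{T}-\frac1T\int_0^T f(t,x+yt,y)\,dt,\ -x+y\right).$$ $B_\rho(0)$ is the open ball of $C^1$ with center $0$ and radius $\rho$; under the identification, $B_\rho(0)\cap\mathbb{R}^2=\{(x,y): \max_{t\in[0,T]}|x+yt|+|y|<\rho\}$ and $\partial B_\rho(0)\cap\mathbb{R}^2=\{(x,y): \max_{t\in[0,T]}|x+yt|+|y|=\rho\}$. $\deg_B$ denotes the Brouwer degree. *)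

theory Defs
  imports "HOL-Analysis.Analysis"
begin

section \<open>Brouwer degree\<close>

text \<open>
  The degree of a continuous map \<open>f\<close> on the closure of a bounded open set \<open>\<Omega>\<close> at a point
  \<open>y \<notin> f(\<partial>\<Omega>)\<close> is the number of solutions of \<open>g x = y\<close> in \<open>\<Omega>\<close>, counted with the sign of the
  Jacobian determinant, of any \<open>g\<close> that is continuous on the closure of \<open>\<Omega>\<close>, is \<open>C\<^sup>1\<close> in \<open>\<Omega>\<close>, has
  \<open>y\<close> as a regular value and is uniformly closer to \<open>f\<close> than the distance from \<open>y\<close> to \<open>f(\<partial>\<Omega>)\<close>.
  For such \<open>\<Omega>\<close>, \<open>f\<close>, \<open>y\<close> some \<open>g\<close> exists, the set of solutions is finite, and the count does not
  depend on \<open>g\<close>.  If \<open>y \<in> f(\<partial>\<Omega>)\<close>, there is no such \<open>g\<close> and the value of the degree is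
  unspecified.
\<close>

text \<open>
  \<open>J\<close> is the Jacobian matrix of \<open>g\<close> on \<open>\<Omega>\<close>.  The pointwise strict estimate is a uniform one
  because the closure of \<open>\<Omega>\<close> is compact.
\<close>

definition regular_approximation ::
  "(real^'n \<Rightarrow> real^'n) \<Rightarrow> (real^'n) set \<Rightarrow> real^'n \<Rightarrow>
   (real^'n \<Rightarrow> real^'n) \<Rightarrow> (real^'n \<Rightarrow> real^'n^'n) \<Rightarrow> bool"
where
  "regular_approximation f \<Omega> y g J \<longleftrightarrow>
     continuous_on (closure \<Omega>) g \<and>
     (\<forall>x\<in>\<Omega>. (g has_derivative (\<lambda>h. J x *v h)) (at x)) \<and>
     continuous_on \<Omega> J \<and>
     (\<forall>x\<in>\<Omega>. g x = y \<longrightarrow> det (J x) \<noteq> 0) \<and>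
     (\<forall>x\<in>closure \<Omega>. dist (g x) (f x) < infdist y (f ` frontier \<Omega>))"

definition brouwer_degree ::
  "(real^'n \<Rightarrow> real^'n) \<Rightarrow> (real^'n) set \<Rightarrow> real^'n \<Rightarrow> int"
where
  "brouwer_degree f \<Omega> y =
     (SOME d. \<exists>g J. regular_approximation f \<Omega> y g J \<and>
        real_of_int d = (\<Sum>x\<in>{x\<in>\<Omega>. g x = y}. sgn (det (J x))))"


section \<open>Function spaces on \<open>[0,T]\<close>\<close>

text \<open>
  Functions on \<open>[0,T]\<close> are total functions of which only the values on \<open>[0,T]\<close> matter.  An element
  of \<open>C\<^sup>1\<close> is represented together with its derivative, which for \<open>T > 0\<close> is unique on \<open>[0,T]\<close>;
  at the end points it is one-sided.
\<close>

definition C1_with_deriv :: "real \<Rightarrow> (real \<Rightarrow> real) \<Rightarrow> (real \<Rightarrow> real) \<Rightarrow> bool"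
where
  "C1_with_deriv T u u' \<longleftrightarrow>
     (\<forall>t\<in>{0..T}. (u has_real_derivative u' t) (at t within {0..T})) \<and>
     continuous_on {0..T} u'"

definition sup_norm :: "real \<Rightarrow> (real \<Rightarrow> real) \<Rightarrow> real"
  where "sup_norm T u = (SUP t\<in>{0..T}. \<bar>u t\<bar>)"

definition C1_norm :: "real \<Rightarrow> (real \<Rightarrow> real) \<Rightarrow> (real \<Rightarrow> real) \<Rightarrow> real"
  where "C1_norm T u u' = sup_norm T u + sup_norm T u'"

definition L1_norm :: "real \<Rightarrow> (real \<Rightarrow> real) \<Rightarrow> real"
  where "L1_norm T u = integral {0..T} (\<lambda>t. \<bar>u t\<bar>)"

definition neg_part :: "real \<Rightarrow> real"
  where "neg_part c = max (- c) 0"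


section \<open>The differential equation and the map on affine functions\<close>

definition solves_phi_ode ::
  "real \<Rightarrow> (real \<Rightarrow> real) \<Rightarrow> (real \<Rightarrow> real \<Rightarrow> real \<Rightarrow> real) \<Rightarrow>
   (real \<Rightarrow> real) \<Rightarrow> (real \<Rightarrow> real) \<Rightarrow> bool"
where
  "solves_phi_ode T \<phi> f u u' \<longleftrightarrow>
     C1_with_deriv T u u' \<and>
     (\<exists>w'. C1_with_deriv T (\<lambda>t. \<phi> (u' t)) w' \<and> (\<forall>t\<in>{0..T}. w' t = f t (u t) (u' t)))"

definition B_map :: "(real \<Rightarrow> real) \<Rightarrow> real \<Rightarrow> real \<Rightarrow> real"
  where "B_map \<phi> b x = \<phi> (b * x) - \<phi> x"

definition G_map ::
  "real \<Rightarrow> (real \<Rightarrow> real) \<Rightarrow> real \<Rightarrow> (real \<Rightarrow> real \<Rightarrow> real \<Rightarrow> real) \<Rightarrow> real^2 \<Rightarrow> real^2"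
where
  "G_map T \<phi> b f v =
     vector [B_map \<phi> b (v$1) / T
               - 1 / T * integral {0..T} (\<lambda>t. f t (v$1 + v$2 * t) (v$2)),
             - v$1 + v$2]"

text \<open>
  The pair \<open>v = (x, y)\<close> stands for the affine function \<open>t \<mapsto> x + y t\<close>, so this is its norm in
  \<open>C\<^sup>1\<close>.
\<close>

definition affine_C1_norm :: "real \<Rightarrow> real^2 \<Rightarrow> real"
  where "affine_C1_norm T v = C1_norm T (\<lambda>t. v$1 + v$2 * t) (\<lambda>t. v$2)"

end

theory Submission
  imports Defs "HOL-Complex_Analysis.Great_Picard"
begin

text \<open>
  Put \<open>a = \<rho> / (2 + T) \<ge> r\<close> and \<open>H b = \<integral> f(t, b + b t, b) dt\<close>.  On the boundary, \<open>G\<close> meets the first axis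
  only at \<open>\<plusminus>(a, a)\<close>, with first component \<open>- H (\<plusminus>a) / T\<close>.  If \<open>H a\<close> and \<open>H (- a)\<close> had the same sign,
  \<open>G\<close> would avoid a ray on the boundary and the signed zeros of a regular approximation would cancel, as
  a winding number computation shows.  So the nonzero degree says that \<open>H a\<close> and \<open>H (- a)\<close> have opposite
  signs.

  Since \<open>u' (0) = u (0)\<close>, the equation \<open>(\<phi> (u'))' = \<lambda> f(t, u, u')\<close> with \<open>u' (0) = y\<close> is an initial value
  problem, and it remains to find a solution with \<open>\<lambda> = 1\<close> and \<open>\<integral> f(t, u, u') = 0\<close>.  Let \<open>(y, \<lambda>)\<close> run along
  the path from \<open>(- a, 0)\<close> over \<open>(- a, 1)\<close> and \<open>(a, 1)\<close> to \<open>(a, 0)\<close>.  At its ends \<open>u\<close> is affine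
  and the integral equals \<open>H (\<plusminus>a)\<close>, so it vanishes for some solution on the path.
  The a priori bound \<open>\<bar>u'\<bar> < r \<le> a\<close> excludes the two pieces with \<open>y = \<plusminus>a\<close>, hence \<open>\<lambda> = 1\<close>.
\<close>

section \<open>Integral equations depending on a parameter\<close>

text \<open>Moves a variable upper limit into the integrand, so that continuity of parameter
  integrals and dominated convergence can be applied on the fixed interval
  \<open>[0, 1]\<close>.\<close>

lemma integral_0_scaled:
  fixes h :: "real \<Rightarrow> 'a::banach"
  assumes "0 \<le> \<tau>"
  shows "integral {0..\<tau>} h = \<tau> *\<^sub>R integral {0..1} (\<lambda>s. h (\<tau> * s))"
proof (cases "\<tau> = 0")
  case False
  then have "(\<lambda>x. x / \<tau>) ` {0..\<tau>} = {0..1}"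
    using assms by (auto simp: image_def field_simps zero_le_mult_iff intro!: bexI[of _ "\<tau> * _"])
  then show ?thesis
    using integral_stretch_real[of \<tau> 0 \<tau> h] False assms by simp
qed simp

text \<open>After rescaling to \<open>[0, 1]\<close> the integrand is jointly continuous, because
  \<open>max 0 (t - \<delta>)\<close> is continuous in \<open>t\<close> and the rescaled argument
  stays in \<open>[0, T]\<close>.\<close>

lemma continuous_on_primitive_param:
  fixes G :: "'b::topological_space \<Rightarrow> real \<Rightarrow> 'a::banach"
  assumes "continuous_on (S \<times> {0..T}) (\<lambda>(\<sigma>, t). G \<sigma> t)" and "0 \<le> \<delta>"
  shows "continuous_on (S \<times> {0..T}) (\<lambda>(\<sigma>, t). integral {0..max 0 (t - \<delta>)} (G \<sigma>))"
proof -
  let ?\<tau> = "\<lambda>t::real. max 0 (t - \<delta>)"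
  have "?\<tau> t * s \<in> {0..T}" if "t \<in> {0..T}" "s \<in> {0..1}" for t s
    using that assms(2) mult_left_le[of s "?\<tau> t"] by auto
  then have "continuous_on ((S \<times> {0..T}) \<times> cbox 0 1) (\<lambda>p. case (fst (fst p), ?\<tau> (snd (fst p)) * snd p) of (\<sigma>, t) \<Rightarrow> G \<sigma> t)"
    by (intro continuous_on_compose2[OF assms(1)] continuous_intros) auto
  then have "continuous_on (S \<times> {0..T}) (\<lambda>p. integral (cbox 0 1) (\<lambda>s. G (fst p) (?\<tau> (snd p) * s)))"
    by (intro integral_continuous_on_param) (simp add: case_prod_unfold)
  then have "continuous_on (S \<times> {0..T})
      (\<lambda>p. ?\<tau> (snd p) *\<^sub>R integral {0..1} (\<lambda>s. G (fst p) (?\<tau> (snd p) * s)))"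
    by (intro continuous_intros) auto
  then show ?thesis
    by (rule continuous_on_eq) (auto intro!: integral_0_scaled[symmetric])
qed

text \<open>Method of steps: the right-hand side at \<open>t\<close> sees \<open>z\<close> only up
  to \<open>t - \<delta>\<close>, so the Picard iterates are stationary for
  \<open>t \<le> k * \<delta>\<close> from the \<open>k\<close>-th one on. Finitely many iterations
  give a solution that is jointly continuous in parameter and time, although \<open>F\<close> is
  only continuous.\<close>

lemma delayed_integral_equation:
  fixes F :: "'b::topological_space \<Rightarrow> real \<Rightarrow> 'a \<Rightarrow> 'a::banach" and z0 :: "'b \<Rightarrow> 'a"
  assumes z0: "continuous_on S z0"
    and F: "continuous_on (S \<times> {0..T} \<times> UNIV) (\<lambda>(\<sigma>, t, x). F \<sigma> t x)"
    and "0 < \<delta>"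
  obtains z where "continuous_on (S \<times> {0..T}) (\<lambda>(\<sigma>, t). z \<sigma> t)"
    and "\<And>\<sigma> t. \<sigma> \<in> S \<Longrightarrow> t \<in> {0..T} \<Longrightarrow>
           z \<sigma> t = z0 \<sigma> + integral {0..max 0 (t - \<delta>)} (\<lambda>s. F \<sigma> s (z \<sigma> s))"
proof -
  define \<Phi> where "\<Phi> z \<sigma> t = z0 \<sigma> + integral {0..max 0 (t - \<delta>)} (\<lambda>s. F \<sigma> s (z \<sigma> s))" for z \<sigma> t
  define y where "y k = (\<Phi> ^^ k) (\<lambda>\<sigma> t. z0 \<sigma>)" for k
  have y_Suc: "y (Suc k) = \<Phi> (y k)" for k
    by (simp add: y_def)
  have cont: "continuous_on (S \<times> {0..T}) (\<lambda>(\<sigma>, t). y k \<sigma> t)" for k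
  proof (induction k)
    case 0
    then show ?case
      by (auto simp: y_def case_prod_unfold intro!: continuous_on_compose2[OF z0] continuous_intros)
  next
    case (Suc k)
    have "continuous_on (S \<times> {0..T})
        (\<lambda>p. (\<lambda>(\<sigma>, t, x). F \<sigma> t x) (fst p, snd p, (\<lambda>(\<sigma>, t). y k \<sigma> t) p))"
      by (intro continuous_on_compose2[OF F] continuous_intros Suc.IH) auto
    then have "continuous_on (S \<times> {0..T}) (\<lambda>(\<sigma>, t). integral {0..max 0 (t - \<delta>)} (\<lambda>s. F \<sigma> s (y k \<sigma> s)))"
      using \<open>0 < \<delta>\<close> by (intro continuous_on_primitive_param) (auto simp: case_prod_unfold)
    moreover have "continuous_on (S \<times> {0..T}) (\<lambda>p. z0 (fst p))"
      by (auto intro!: continuous_on_compose2[OF z0] continuous_intros)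
    ultimately show ?case
      by (simp add: y_Suc \<Phi>_def case_prod_unfold continuous_on_add)
  qed
  have stable: "y (Suc k) \<sigma> t = y k \<sigma> t" if "t \<le> k * \<delta>" for k \<sigma> t
    using that
  proof (induction k arbitrary: t)
    case 0
    then show ?case using \<open>0 < \<delta>\<close> by (simp add: y_def \<Phi>_def)
  next
    case (Suc k)
    have "y (Suc k) \<sigma> s = y k \<sigma> s" if "s \<in> {0..max 0 (t - \<delta>)}" for s
    proof (rule Suc.IH)
      have "t - \<delta> \<le> real k * \<delta>" "0 \<le> real k * \<delta>"
        using Suc.prems \<open>0 < \<delta>\<close> by (auto simp: algebra_simps)
      then show "s \<le> real k * \<delta>"
        using that by auto
    qed
    then have "integral {0..max 0 (t - \<delta>)} (\<lambda>s. F \<sigma> s (y (Suc k) \<sigma> s)) =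
        integral {0..max 0 (t - \<delta>)} (\<lambda>s. F \<sigma> s (y k \<sigma> s))"
      by (intro integral_cong) metis
    then have "\<Phi> (y (Suc k)) \<sigma> t = \<Phi> (y k) \<sigma> t"
      unfolding \<Phi>_def by (rule arg_cong)
    then show ?case
      by (metis y_Suc)
  qed
  obtain N where N: "T \<le> real N * \<delta>"
    using \<open>0 < \<delta>\<close> by (metis less_imp_le reals_Archimedean3)
  have "y N \<sigma> t = \<Phi> (y N) \<sigma> t" if "t \<in> {0..T}" for \<sigma> t
  proof -
    have "t \<le> real N * \<delta>"
      using that N by simp
    then show ?thesis
      by (metis stable y_Suc)
  qed
  then show ?thesis
    using cont[of N] unfolding \<Phi>_def by (rule that[of "y N", rotated])
qed

text \<open>Tonelli's proof of Peano's theorem with a moving parameter. The bound \<open>K\<close>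
  makes the \<open>z n\<close> uniformly bounded and equi-Lipschitz; compactness of \<open>S\<close>
  and Arzela-Ascoli give a convergent subsequence, and dominated convergence carries the equation to
  the limit as the delay vanishes.\<close>

lemma delayed_integral_equation_limit:
  fixes F :: "'b::metric_space \<Rightarrow> real \<Rightarrow> 'a \<Rightarrow> 'a::euclidean_space" and z0 :: "'b \<Rightarrow> 'a"
  assumes "compact S" and z0: "continuous_on S z0"
    and F: "continuous_on (S \<times> {0..T} \<times> UNIV) (\<lambda>(\<sigma>, t, x). F \<sigma> t x)"
    and K: "\<And>\<sigma> t x. \<sigma> \<in> S \<Longrightarrow> t \<in> {0..T} \<Longrightarrow> norm (F \<sigma> t x) \<le> K"
    and \<sigma>: "\<And>n. \<sigma> n \<in> S"
    and \<delta>: "\<And>n. 0 \<le> \<delta> n" "\<delta> \<longlonglongrightarrow> 0"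
    and z_cont: "\<And>n. continuous_on {0..T} (z n)"
    and z_eq: "\<And>n t. t \<in> {0..T} \<Longrightarrow>
           z n t = z0 (\<sigma> n) + integral {0..max 0 (t - \<delta> n)} (\<lambda>s. F (\<sigma> n) s (z n s))"
  obtains k :: "nat \<Rightarrow> nat" and \<tau> y where "strict_mono k" "\<tau> \<in> S" "(\<sigma> \<circ> k) \<longlonglongrightarrow> \<tau>"
    and "continuous_on {0..T} y" "\<And>t. t \<in> {0..T} \<Longrightarrow> (\<lambda>n. z (k n) t) \<longlonglongrightarrow> y t"
    and "\<And>t. t \<in> {0..T} \<Longrightarrow> y t = z0 \<tau> + integral {0..t} (\<lambda>s. F \<tau> s (y s))"
proof -
  obtain \<tau> k1 where \<tau>: "\<tau> \<in> S" and k1: "strict_mono k1" "(\<sigma> \<circ> k1) \<longlonglongrightarrow> \<tau>"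
    using \<open>compact S\<close> \<sigma> unfolding compact_def by metis
  have K0: "0 \<le> K" if "0 \<le> T"
    using order_trans[OF norm_ge_zero K[OF \<tau>, of 0 undefined]] that by simp
  have F_cont: "continuous_on {0..T} (\<lambda>s. F \<sigma>' s (x s))"
    if "\<sigma>' \<in> S" "continuous_on {0..T} x" for \<sigma>' x
  proof -
    have "continuous_on {0..T} (\<lambda>s. (\<lambda>(\<sigma>, t, x). F \<sigma> t x) (\<sigma>', s, x s))"
      using that by (intro continuous_on_compose2[OF F] continuous_intros) auto
    then show ?thesis by simp
  qed
  have F_int: "(\<lambda>s. F (\<sigma> n) s (z n s)) integrable_on {a..b}" if "0 \<le> a" "b \<le> T" for n a b
    using F_cont[OF \<sigma> z_cont] that
    by (intro integrable_continuous_real) (rule continuous_on_subset, auto)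
  have lip: "norm (z n t - z n t') \<le> K * \<bar>t - t'\<bar>" if "t \<in> {0..T}" "t' \<in> {0..T}" "t' \<le> t" for n t t'
  proof -
    let ?a = "max 0 (t' - \<delta> n)" and ?b = "max 0 (t - \<delta> n)"
    have "0 \<le> ?a" "?a \<le> ?b" "?b \<le> T"
      using that \<delta>(1)[of n] by auto
    then have "z n t - z n t' = integral {?a..?b} (\<lambda>s. F (\<sigma> n) s (z n s))"
      using Henstock_Kurzweil_Integration.integral_combine[OF _ _ F_int[of 0 ?b n], of ?a]
      by (auto simp: z_eq[OF that(1)] z_eq[OF that(2)] algebra_simps)
    moreover have "norm (integral {?a..?b} (\<lambda>s. F (\<sigma> n) s (z n s))) \<le> K * (?b - ?a)"
      using \<open>?a \<le> ?b\<close> \<open>?b \<le> T\<close> K[OF \<sigma>]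
      by (intro integral_bound continuous_on_subset[OF F_cont[OF \<sigma> z_cont]]) auto
    moreover have "K * (?b - ?a) \<le> K * \<bar>t - t'\<bar>"
      using that K0 by (intro mult_left_mono) auto
    ultimately show ?thesis by simp
  qed
  have lip': "norm (z n t - z n t') \<le> K * \<bar>t - t'\<bar>" if "t \<in> {0..T}" "t' \<in> {0..T}" for n t t'
    using lip[of t t' n] lip[of t' t n] that
    by (cases "t' \<le> t") (auto simp: norm_minus_commute abs_minus_commute)
  obtain M where M: "\<And>x. x \<in> S \<Longrightarrow> norm (z0 x) \<le> M"
    using compact_imp_bounded[OF compact_continuous_image[OF z0 \<open>compact S\<close>]]
    by (auto simp: bounded_iff)
  have bound: "norm (z n t) \<le> M + K * T" if "t \<in> {0..T}" for n t
  proof -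
    have "0 \<in> {0..T}" and "z n 0 = z0 (\<sigma> n)"
      using that z_eq[of 0 n] \<delta>(1)[of n] by auto
    then have "norm (z n t) \<le> M + K * t"
      using norm_triangle_sub[of "z n t" "z n 0"] M[OF \<sigma>, of n] lip'[OF that, of 0 n] that by simp
    then show ?thesis
      using that K0 mult_left_mono[of t T K] by simp
  qed
  have equi: "\<exists>d>0. \<forall>n y. y \<in> {0..T} \<and> norm (x - y) < d \<longrightarrow> norm (z (k1 n) x - z (k1 n) y) < e"
    if "x \<in> {0..T}" "0 < e" for x e
  \<comment> \<open>The added 1 keeps the denominator positive if \<open>K = 0\<close>.\<close>
  proof (intro exI[of _ "e / (K + 1)"] conjI allI impI)
    show "0 < e / (K + 1)"
      using K0 that by simp
    fix n y assume y: "y \<in> {0..T} \<and> norm (x - y) < e / (K + 1)"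
    then have "(K + 1) * \<bar>x - y\<bar> < e"
      using K0 that by (simp add: field_simps)
    moreover have "K * \<bar>x - y\<bar> \<le> (K + 1) * \<bar>x - y\<bar>"
      by (simp add: algebra_simps)
    ultimately show "norm (z (k1 n) x - z (k1 n) y) < e"
      using lip'[of x y "k1 n"] that y by linarith
  qed
  obtain y k2 where y: "continuous_on {0..T} y" and k2: "strict_mono (k2 :: nat \<Rightarrow> nat)"
    and lim: "\<And>e. 0 < e \<Longrightarrow> \<exists>N. \<forall>n x. n \<ge> N \<and> x \<in> {0..T} \<longrightarrow> norm (z (k1 (k2 n)) x - y x) < e"
    by (rule Arzela_Ascoli[of "{0..T}" "\<lambda>n. z (k1 n)" "M + K * T"]) (use bound equi in auto)
  define k where "k = k1 \<circ> k2"
  have k: "strict_mono k"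
    using k1 k2 by (simp add: k_def strict_mono_o)
  have \<sigma>_lim: "(\<sigma> \<circ> k) \<longlonglongrightarrow> \<tau>"
    using LIMSEQ_subseq_LIMSEQ[OF k1(2) k2] by (simp add: k_def o_assoc)
  have unif: "uniform_limit {0..T} (\<lambda>n. z (k n)) y sequentially"
    using lim unfolding uniform_limit_sequentially_iff dist_norm k_def comp_def by blast
  have pt: "(\<lambda>n. z (k n) t) \<longlonglongrightarrow> y t" if "t \<in> {0..T}" for t
    by (rule tendsto_uniform_limitI[OF unif that])
  have "y t = z0 \<tau> + integral {0..t} (\<lambda>s. F \<tau> s (y s))" if t: "t \<in> {0..T}" for t
  proof -
    \<comment> \<open>The upper limit and the integrand both vary with \<open>n\<close>; after
      rescaling to \<open>[0, 1]\<close> the constant \<open>K\<close> dominates all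
      integrands.\<close>
    define b where "b n = max 0 (t - \<delta> (k n))" for n
    have b: "b n \<in> {0..T}" "0 \<le> b n" for n
      using t \<delta>(1)[of "k n"] by (auto simp: b_def)
    have "(\<lambda>n. max 0 (t - \<delta> (k n))) \<longlonglongrightarrow> max 0 (t - 0)"
      using LIMSEQ_subseq_LIMSEQ[OF \<delta>(2) k] by (intro tendsto_intros) (simp add: o_def)
    then have b_lim: "b \<longlonglongrightarrow> t"
      using t by (simp add: b_def[abs_def])
    have in_T: "a * s \<in> {0..T}" if "a \<in> {0..T}" "s \<in> {0..1}" for a s :: real
      using that mult_left_le[of s a] by auto
    let ?f = "\<lambda>n s. F (\<sigma> (k n)) (b n * s) (z (k n) (b n * s))"
    have "(\<lambda>n. integral {0..1} (?f n)) \<longlonglongrightarrow> integral {0..1} (\<lambda>s. F \<tau> (t * s) (y (t * s)))"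
    proof (rule dominated_convergence(2)[where h = "\<lambda>_. K"])
      show "?f n integrable_on {0..1}" for n
      proof (rule integrable_continuous_real)
        show "continuous_on {0..1} (?f n)"
          using in_T[OF b(1)]
          by (intro continuous_on_compose2[OF F_cont[OF \<sigma> z_cont], where f = "\<lambda>s. b n * s"])
            (auto intro!: continuous_intros)
      qed
      show "(\<lambda>_. K) integrable_on {0..1::real}"
        by (rule integrable_continuous_real) (rule continuous_on_const)
      show "norm (?f n s) \<le> K" if "s \<in> {0..1}" for n s
        by (rule K[OF \<sigma> in_T[OF b(1) that]])
      show "(\<lambda>n. ?f n s) \<longlonglongrightarrow> F \<tau> (t * s) (y (t * s))" if s: "s \<in> {0..1}" for s
      proof -
        have bs: "(\<lambda>n. b n * s) \<longlonglongrightarrow> t * s"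
          by (intro tendsto_intros b_lim)
        have "(\<lambda>n. y (b n * s)) \<longlonglongrightarrow> y (t * s)"
          using in_T[OF b(1) s] in_T[OF t s]
          by (intro continuous_on_tendsto_compose[OF y bs]) auto
        \<comment> \<open>The argument \<open>b n * s\<close> moves with \<open>n\<close>, so the
          uniform convergence from Arzela-Ascoli is used, not only the pointwise one.\<close>
        moreover have "(\<lambda>n. z (k n) (b n * s) - y (b n * s)) \<longlonglongrightarrow> 0"
        proof (rule LIMSEQ_I)
          fix e :: real assume "0 < e"
          then show "\<exists>N. \<forall>n\<ge>N. norm (z (k n) (b n * s) - y (b n * s) - 0) < e"
            using lim[of e] in_T[OF b(1) s] by (fastforce simp: k_def)
        qed
        ultimately have "(\<lambda>n. z (k n) (b n * s)) \<longlonglongrightarrow> y (t * s)"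
          by (rule Lim_transform)
        then have "(\<lambda>n. (\<sigma> (k n), b n * s, z (k n) (b n * s))) \<longlonglongrightarrow> (\<tau>, t * s, y (t * s))"
          using \<sigma>_lim bs by (intro tendsto_Pair) (auto simp: o_def)
        from continuous_on_tendsto_compose[OF F this] show ?thesis
          using \<sigma> \<tau> in_T[OF b(1) s] in_T[OF t s] by auto
      qed
    qed
    then have "(\<lambda>n. z0 (\<sigma> (k n)) + b n *\<^sub>R integral {0..1} (?f n))
        \<longlonglongrightarrow> z0 \<tau> + t *\<^sub>R integral {0..1} (\<lambda>s. F \<tau> (t * s) (y (t * s)))"
      using continuous_on_tendsto_compose[OF z0 \<sigma>_lim] \<sigma> \<tau> b_lim
      by (intro tendsto_intros) (auto simp: o_def)
    moreover have "z (k n) t = z0 (\<sigma> (k n)) + b n *\<^sub>R integral {0..1} (?f n)" for n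
      unfolding z_eq[OF t] b_def[symmetric] by (subst integral_0_scaled[OF b(2)]) (rule refl)
    ultimately have "(\<lambda>n. z (k n) t) \<longlonglongrightarrow> z0 \<tau> + t *\<^sub>R integral {0..1} (\<lambda>s. F \<tau> (t * s) (y (t * s)))"
      by simp
    then have "y t = z0 \<tau> + t *\<^sub>R integral {0..1} (\<lambda>s. F \<tau> (t * s) (y (t * s)))"
      by (rule LIMSEQ_unique[OF pt[OF t]])
    also have "\<dots> = z0 \<tau> + integral {0..t} (\<lambda>s. F \<tau> s (y s))"
      using t by (subst integral_0_scaled) auto
    finally show ?thesis .
  qed
  with k \<tau> \<sigma>_lim y pt show ?thesis
    by (rule that)
qed

text \<open>
  Solutions need not be unique, so \<open>E (z T)\<close> is not a function of \<open>\<sigma>\<close> and the intermediate value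
  theorem is applied to the delayed equation instead.
\<close>

lemma integral_equation_intermediate_value:
  fixes F :: "real \<Rightarrow> real \<Rightarrow> 'a \<Rightarrow> 'a::euclidean_space" and z0 :: "real \<Rightarrow> 'a" and E :: "'a \<Rightarrow> real"
  assumes "0 < T" "p \<le> q" and z0: "continuous_on {p..q} z0"
    and F: "continuous_on ({p..q} \<times> {0..T} \<times> UNIV) (\<lambda>(\<sigma>, t, x). F \<sigma> t x)"
    and K: "\<And>\<sigma> t x. \<sigma> \<in> {p..q} \<Longrightarrow> t \<in> {0..T} \<Longrightarrow> norm (F \<sigma> t x) \<le> K"
    and E: "continuous_on UNIV E"
    and neg: "\<And>z. continuous_on {0..T} z \<Longrightarrow>
           (\<And>t. t \<in> {0..T} \<Longrightarrow> z t = z0 p + integral {0..t} (\<lambda>s. F p s (z s))) \<Longrightarrow> E (z T) < 0"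
    and pos: "\<And>z. continuous_on {0..T} z \<Longrightarrow>
           (\<And>t. t \<in> {0..T} \<Longrightarrow> z t = z0 q + integral {0..t} (\<lambda>s. F q s (z s))) \<Longrightarrow> E (z T) > 0"
  obtains \<sigma> z where "\<sigma> \<in> {p..q}" "continuous_on {0..T} z"
    "\<And>t. t \<in> {0..T} \<Longrightarrow> z t = z0 \<sigma> + integral {0..t} (\<lambda>s. F \<sigma> s (z s))" "E (z T) = 0"
proof -
  \<comment> \<open>A pair in \<open>C\<close> is a zero of \<open>E\<close> or an end point at
    which \<open>E\<close> has the wrong sign. Unlike strict sign conditions, membership in this
    closed set survives the limit, where \<open>neg\<close> and \<open>pos\<close> then rule out the
    wrong signs.\<close>
  define C where "C = {p..q} \<times> {0} \<union> {p} \<times> {0..} \<union> {q} \<times> {..0::real}"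
  have "closed C"
    unfolding C_def by (intro closed_Un closed_Times) auto
  have "\<exists>\<sigma> z. \<sigma> \<in> {p..q} \<and> continuous_on {0..T} z \<and> (\<forall>t\<in>{0..T}. z t = z0 \<sigma> +
      integral {0..max 0 (t - 1 / Suc n)} (\<lambda>s. F \<sigma> s (z s))) \<and> (\<sigma>, E (z T)) \<in> C" for n
  proof -
    obtain z where z: "continuous_on ({p..q} \<times> {0..T}) (\<lambda>(\<sigma>, t). z \<sigma> t)"
      and z_eq: "\<And>\<sigma> t. \<sigma> \<in> {p..q} \<Longrightarrow> t \<in> {0..T} \<Longrightarrow>
        z \<sigma> t = z0 \<sigma> + integral {0..max 0 (t - 1 / Suc n)} (\<lambda>s. F \<sigma> s (z \<sigma> s))"
      using delayed_integral_equation[OF z0 F, of "1 / Suc n"] by auto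
    have "continuous_on {p..q} (\<lambda>\<sigma>. (\<lambda>(\<sigma>, t). z \<sigma> t) (\<sigma>, T))"
      using \<open>0 < T\<close> by (intro continuous_on_compose2[OF z] continuous_intros) auto
    then have cont: "continuous_on {p..q} (\<lambda>\<sigma>. E (z \<sigma> T))"
      by (intro continuous_on_compose2[OF E]) auto
    have "\<exists>\<sigma>\<in>{p..q}. (\<sigma>, E (z \<sigma> T)) \<in> C"
    \<comment> \<open>The signs at \<open>p\<close> and \<open>q\<close> are known only for the
      equation without delay. If they fail for the delayed one, an end point itself gives a pair in
      \<open>C\<close>.\<close>
    proof (cases "E (z p T) \<le> 0 \<and> 0 \<le> E (z q T)")
      case True
      then obtain \<sigma> where "p \<le> \<sigma>" "\<sigma> \<le> q" "E (z \<sigma> T) = 0"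
        using IVT'[OF _ _ \<open>p \<le> q\<close> cont] by auto
      then show ?thesis
        unfolding C_def by force
    next
      case False
      then have "(p, E (z p T)) \<in> C \<or> (q, E (z q T)) \<in> C"
        by (auto simp: C_def)
      then show ?thesis
        using \<open>p \<le> q\<close> by auto
    qed
    then obtain \<sigma> where \<sigma>: "\<sigma> \<in> {p..q}" "(\<sigma>, E (z \<sigma> T)) \<in> C"
      by blast
    have "continuous_on {0..T} (\<lambda>t. (\<lambda>(\<sigma>, t). z \<sigma> t) (\<sigma>, t))"
      using \<sigma> by (intro continuous_on_compose2[OF z] continuous_intros) auto
    then have "continuous_on {0..T} (z \<sigma>)"
      by simp
    then show ?thesis
      using \<sigma> z_eq by blast
  qed
  then obtain \<sigma> z where \<sigma>: "\<And>n. \<sigma> n \<in> {p..q}" and z: "\<And>n. continuous_on {0..T} (z n)"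
    and z_eq: "\<And>n t. t \<in> {0..T} \<Longrightarrow>
      z n t = z0 (\<sigma> n) + integral {0..max 0 (t - 1 / Suc n)} (\<lambda>s. F (\<sigma> n) s (z n s))"
    and C: "\<And>n. (\<sigma> n, E (z n T)) \<in> C"
    by metis
  have \<delta>: "(\<lambda>n. 1 / Suc n) \<longlonglongrightarrow> (0::real)"
    using LIMSEQ_inverse_real_of_nat by (simp add: inverse_eq_divide)
  obtain k \<tau> y where k: "strict_mono k" and \<tau>: "\<tau> \<in> {p..q}" "(\<sigma> \<circ> k) \<longlonglongrightarrow> \<tau>"
    and y: "continuous_on {0..T} y" and lim: "\<And>t. t \<in> {0..T} \<Longrightarrow> (\<lambda>n. z (k n) t) \<longlonglongrightarrow> y t"
    and y_eq: "\<And>t. t \<in> {0..T} \<Longrightarrow> y t = z0 \<tau> + integral {0..t} (\<lambda>s. F \<tau> s (y s))"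
    by (rule delayed_integral_equation_limit[OF compact_Icc z0 F K \<sigma> _ \<delta> z z_eq]) auto
  have "(\<lambda>n. (\<sigma> (k n), E (z (k n) T))) \<longlonglongrightarrow> (\<tau>, E (y T))"
    using \<tau> \<open>0 < T\<close>
    by (intro tendsto_Pair continuous_on_tendsto_compose[OF E lim]) (auto simp: o_def)
  then have "(\<tau>, E (y T)) \<in> C"
    using \<open>closed C\<close> C by (rule closed_sequentially[rotated 2])
  moreover have "\<tau> \<noteq> p \<or> E (y T) < 0"
    using neg[OF y] y_eq by blast
  moreover have "\<tau> \<noteq> q \<or> E (y T) > 0"
    using pos[OF y] y_eq by blast
  ultimately have "E (y T) = 0"
    by (auto simp: C_def)
  with \<tau>(1) y y_eq show ?thesis
    by (rule that)
qed

section \<open>Sign change implies solvability\<close>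

text \<open>A continuous injective function on the line is strictly monotone, so \<open>g x\<close>
  lies strictly between \<open>g a\<close> and \<open>g b\<close>; this covers increasing and
  decreasing homeomorphisms alike.\<close>

lemma abs_less_max_endpoints:
  fixes g :: "real \<Rightarrow> real"
  assumes "continuous_on UNIV g" "inj g" "a < x" "x < b"
  shows "\<bar>g x\<bar> < max \<bar>g b\<bar> \<bar>g a\<bar>"
proof -
  have "g a < g x \<and> g x < g b \<or> g b < g x \<and> g x < g a"
    using assms by (intro continuous_inj_imp_mono) (auto intro: continuous_on_subset inj_on_subset)
  then show ?thesis by auto
qed

lemma continuous_on_superposition:
  fixes f :: "real \<Rightarrow> real \<Rightarrow> real \<Rightarrow> real"
  assumes "continuous_on ({0..T} \<times> UNIV \<times> UNIV) (\<lambda>(t, x, y). f t x y)"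
    and "continuous_on S u" "continuous_on S y" "S \<subseteq> {0..T}"
  shows "continuous_on S (\<lambda>t. f t (u t) (y t))"
proof -
  have "continuous_on S (\<lambda>t. (\<lambda>(t, x, y). f t x y) (t, u t, y t))"
    using assms by (intro continuous_on_compose2[OF assms(1)] continuous_intros) auto
  then show ?thesis by simp
qed

lemma C1_with_deriv_continuous:
  assumes "C1_with_deriv T u u'"
  shows "continuous_on {0..T} u" "continuous_on {0..T} u'"
  using assms unfolding C1_with_deriv_def
  by (auto intro: DERIV_continuous_on)

lemma C1_with_deriv_primitive:
  assumes "continuous_on {0..T} g" "\<And>t. t \<in> {0..T} \<Longrightarrow> u t = k + integral {0..t} g"
  shows "C1_with_deriv T u g"
  unfolding C1_with_deriv_def
proof (intro conjI ballI assms(1))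
  fix t assume t: "t \<in> {0..T}"
  have "((\<lambda>t. k + integral {0..t} g) has_real_derivative g t) (at t within {0..T})"
    using integral_has_real_derivative[OF assms(1) t]
    by (auto intro!: derivative_eq_intros)
  then show "(u has_real_derivative g t) (at t within {0..T})"
    by (rule has_field_derivative_transform_within[OF _ zero_less_one t]) (simp add: assms(2))
qed

text \<open>
  Here \<open>y\<close> is the truncation of \<open>\<psi> (w t)\<close> to \<open>[-a, a]\<close>.  By (ii) it takes a value in
  \<open>]M\<^sub>1, M\<^sub>2[\<close>, and \<open>\<bar>f\<bar> \<le> f + 2 c\<^sup>-\<close> bounds the variation of \<open>w\<close>; so the truncation was inactive.
\<close>

lemma a_priori_bound:
  fixes T M\<^sub>1 M\<^sub>2 L r a \<kappa> \<mu> :: real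
    and \<phi> \<psi> c u w y :: "real \<Rightarrow> real"
    and f :: "real \<Rightarrow> real \<Rightarrow> real \<Rightarrow> real"
  assumes "T > 0"
    and hom: "homeomorphism UNIV UNIV \<phi> \<psi>"
    and f: "continuous_on ({0..T} \<times> UNIV \<times> UNIV) (\<lambda>(t, x, y). f t x y)"
    and c: "continuous_on {0..T} c"
    and fc: "\<And>t x y. t \<in> {0..T} \<Longrightarrow> f t x y \<ge> c t"
    and M2: "\<And>u u'. C1_with_deriv T u u' \<Longrightarrow> (INF t\<in>{0..T}. u' t) \<ge> M\<^sub>2 \<Longrightarrow>
           integral {0..T} (\<lambda>t. f t (u t) (u' t)) \<noteq> 0"
    and M1: "\<And>u u'. C1_with_deriv T u u' \<Longrightarrow> (SUP t\<in>{0..T}. u' t) \<le> M\<^sub>1 \<Longrightarrow>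
           integral {0..T} (\<lambda>t. f t (u t) (u' t)) \<noteq> 0"
    and L: "L = max \<bar>\<phi> M\<^sub>2\<bar> \<bar>\<phi> M\<^sub>1\<bar>"
    and r: "r = max \<bar>\<psi> (L + 2 * L1_norm T (\<lambda>t. neg_part (c t)))\<bar>
                 \<bar>\<psi> (- L - 2 * L1_norm T (\<lambda>t. neg_part (c t)))\<bar>"
    and M_a: "- a \<le> M\<^sub>1" "M\<^sub>1 < M\<^sub>2" "M\<^sub>2 \<le> a"
    and \<mu>: "0 \<le> \<mu>" "\<mu> \<le> 1"
    and u: "C1_with_deriv T u y"
    and int_0: "integral {0..T} (\<lambda>t. f t (u t) (y t)) = 0"
    and w: "\<And>t. t \<in> {0..T} \<Longrightarrow> w t = \<kappa> + \<mu> * integral {0..t} (\<lambda>s. f s (u s) (y s))"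
    and y: "\<And>t. t \<in> {0..T} \<Longrightarrow> y t = max (- a) (min a (\<psi> (w t)))"
    and t: "t \<in> {0..T}"
  shows "\<bar>\<psi> (w t)\<bar> < r"
proof -
  define N where "N = L1_norm T (\<lambda>t. neg_part (c t))"
  let ?f = "\<lambda>t. f t (u t) (y t)"
  have u_cont: "continuous_on {0..T} u" and y_cont: "continuous_on {0..T} y"
    using C1_with_deriv_continuous[OF u] by auto
  have f_cont: "continuous_on {0..T} ?f"
    by (rule continuous_on_superposition[OF f u_cont y_cont]) simp
  have y_compact: "compact (y ` {0..T})"
    by (rule compact_continuous_image[OF y_cont compact_Icc])
  \<comment> \<open>The integral along \<open>u\<close> vanishes, so (ii) forbids that
    \<open>y\<close> stays above \<open>M\<^sub>2\<close>, and below that it stays under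
    \<open>M\<^sub>1\<close>.\<close>
  have "\<not> (INF t\<in>{0..T}. y t) \<ge> M\<^sub>2"
    using M2[OF u] int_0 by blast
  then obtain t2 where t2: "t2 \<in> {0..T}" "y t2 < M\<^sub>2"
    using \<open>T > 0\<close> by (metis atLeastatMost_empty_iff2 cINF_greatest less_imp_le linorder_not_le)
  have "\<not> (SUP t\<in>{0..T}. y t) \<le> M\<^sub>1"
    using M1[OF u] int_0 by blast
  then obtain t1 where t1: "t1 \<in> {0..T}" "M\<^sub>1 < y t1"
    using \<open>T > 0\<close> by (metis atLeastatMost_empty_iff2 cSUP_least less_imp_le linorder_not_le)
  obtain \<omega> where \<omega>: "\<omega> \<in> {0..T}" "M\<^sub>1 < y \<omega>" "y \<omega> < M\<^sub>2"
  proof (cases "y t1 < M\<^sub>2 \<or> M\<^sub>1 < y t2")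
    case True
    then show ?thesis using t1 t2 that by blast
  next
    case False
    \<comment> \<open>In this case \<open>y t2 \<le> M\<^sub>1\<close> and
      \<open>M\<^sub>2 \<le> y t1\<close>, so \<open>y\<close> passes through the midpoint.\<close>
    have "connected (y ` {0..T})"
      by (rule connected_continuous_image[OF y_cont connected_Icc])
    moreover have "y t2 \<in> y ` {0..T}" "y t1 \<in> y ` {0..T}" "y t2 \<le> (M\<^sub>1 + M\<^sub>2) / 2" "(M\<^sub>1 + M\<^sub>2) / 2 \<le> y t1"
      using t1 t2 False M_a by auto
    ultimately have "(M\<^sub>1 + M\<^sub>2) / 2 \<in> y ` {0..T}"
      by (rule connectedD_interval)
    then show ?thesis
      using that M_a(2) by (auto simp: field_simps)
  qed
  \<comment> \<open>The value \<open>y \<omega>\<close> lies strictly between \<open>-a\<close> and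
    \<open>a\<close>, so the truncation does not act at \<open>\<omega>\<close>.\<close>
  have "\<psi> (w \<omega>) = y \<omega>"
    using \<omega> M_a y[OF \<omega>(1)] by (auto simp: max_def min_def split: if_splits)
  then have "w \<omega> = \<phi> (y \<omega>)"
    using hom by (metis UNIV_I homeomorphism_apply2)
  then have w_\<omega>: "\<bar>w \<omega>\<bar> < L"
    using hom \<omega> abs_less_max_endpoints[of \<phi> "M\<^sub>1" "y \<omega>" "M\<^sub>2"] unfolding L
    by (simp add: homeomorphism_def) (metis inj_on_def UNIV_I)
  have np_cont: "continuous_on {0..T} (\<lambda>t. neg_part (c t))"
    unfolding neg_part_def by (intro continuous_intros c)
  have abs_f: "\<bar>?f s\<bar> \<le> ?f s + 2 * \<bar>neg_part (c s)\<bar>" if "s \<in> {0..T}" for s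
    using fc[OF that, of "u s" "y s"] by (auto simp: neg_part_def max_def abs_if)
  have abs_int: "(\<lambda>s. \<bar>?f s\<bar>) integrable_on {0..T}" and np_int: "(\<lambda>s. \<bar>neg_part (c s)\<bar>) integrable_on {0..T}"
    and f_int: "?f integrable_on {0..T}"
    by (intro integrable_continuous_real continuous_intros f_cont np_cont)+
  \<comment> \<open>Because \<open>f\<close> has integral 0 along \<open>u\<close>, its total
    variation is controlled by the negative part of \<open>c\<close> alone.\<close>
  have "integral {0..T} (\<lambda>s. \<bar>?f s\<bar>) \<le> integral {0..T} (\<lambda>s. ?f s + 2 * \<bar>neg_part (c s)\<bar>)"
    using abs_f by (intro integral_le abs_int integrable_add f_int integrable_on_mult_right np_int)
  also have "\<dots> = 2 * N"
    using int_0 f_int np_int by (simp add: integral_add integrable_on_mult_right N_def L1_norm_def)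
  finally have total: "integral {0..T} (\<lambda>s. \<bar>?f s\<bar>) \<le> 2 * N" .
  have variation: "\<bar>w t - w t'\<bar> \<le> 2 * N" if "t \<in> {0..T}" "t' \<in> {0..T}" "t' \<le> t" for t t'
  proof -
    have sub: "{t'..t} \<subseteq> {0..T}" "{0..t} \<subseteq> {0..T}"
      using that by auto
    have eq: "integral {0..t'} ?f + integral {t'..t} ?f = integral {0..t} ?f"
      using that by (intro Henstock_Kurzweil_Integration.integral_combine
        integrable_subinterval_real[OF f_int sub(2)]) auto
    have "w t - w t' = \<mu> * integral {t'..t} ?f"
      unfolding w[OF that(1)] w[OF that(2)] eq[symmetric] by (simp add: algebra_simps)
    then have "\<bar>w t - w t'\<bar> \<le> \<bar>integral {t'..t} ?f\<bar>"
      using \<mu> by (simp add: abs_mult mult_left_le_one_le)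
    also have "\<dots> \<le> integral {t'..t} (\<lambda>s. \<bar>?f s\<bar>)"
      using integral_norm_bound_integral[OF integrable_subinterval_real[OF f_int sub(1)]
          integrable_subinterval_real[OF abs_int sub(1)]] by simp
    also have "\<dots> \<le> integral {0..T} (\<lambda>s. \<bar>?f s\<bar>)"
      using sub by (intro integral_subset_le integrable_subinterval_real[OF abs_int sub(1)] abs_int) auto
    finally show ?thesis
      using total by simp
  qed
  have "\<bar>w t - w \<omega>\<bar> \<le> 2 * N"
    using variation[of t \<omega>] variation[of \<omega> t] t \<omega>(1) by (cases "\<omega> \<le> t") (auto simp: abs_minus_commute)
  with w_\<omega> have "- L - 2 * N < w t" "w t < L + 2 * N"
    by linarith+
  then show ?thesis
    using hom abs_less_max_endpoints[of \<psi> "- L - 2 * N" "w t" "L + 2 * N"] unfolding r N_def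
    by (simp add: homeomorphism_def) (metis inj_on_def UNIV_I)
qed

text \<open>If the modulus is not integrable, \<open>integral\<close> has the default value
  0.\<close>

lemma L1_norm_nonneg: "0 \<le> L1_norm T u"
  unfolding L1_norm_def by (cases "(\<lambda>t. \<bar>u t\<bar>) integrable_on {0..T}")
    (auto intro: integral_nonneg simp: not_integrable_integral)

section \<open>Shooting along a path of initial data\<close>

lemma pair_integral_equation:
  fixes x :: "real \<Rightarrow> real \<times> real"
  assumes "continuous_on {0..t} g" "continuous_on {0..t} h"
    and "x t = (p, q) + integral {0..t} (\<lambda>s. (g s, h s))"
  shows "fst (x t) = p + integral {0..t} g" "snd (x t) = q + integral {0..t} h"
proof -
  have int: "(\<lambda>s. (g s, h s)) integrable_on {0..t}"
    by (intro integrable_continuous_real continuous_intros assms)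
  show "fst (x t) = p + integral {0..t} g" "snd (x t) = q + integral {0..t} h"
    using integral_linear[OF int bounded_linear_fst] integral_linear[OF int bounded_linear_snd]
    by (auto simp: assms(3) o_def)
qed

text \<open>The unknown of the integral equation is the pair of \<open>u\<close> and the primitive
  of \<open>f(t, u, u')\<close>. Truncating \<open>u\<close> and \<open>u'\<close> makes its
  right-hand side bounded; the intermediate value argument then finds a parameter at which the
  second component vanishes at \<open>T\<close>, and the a priori bound removes the truncation of
  \<open>u'\<close>.\<close>

lemma phi_laplacian_solution:
  fixes T M\<^sub>1 M\<^sub>2 L r a :: real
    and \<phi> \<psi> c :: "real \<Rightarrow> real"
    and f :: "real \<Rightarrow> real \<Rightarrow> real \<Rightarrow> real"
  assumes "T > 0"
    and hom: "homeomorphism UNIV UNIV \<phi> \<psi>"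
    and f: "continuous_on ({0..T} \<times> UNIV \<times> UNIV) (\<lambda>(t, x, y). f t x y)"
    and c: "continuous_on {0..T} c"
    and fc: "\<And>t x y. t \<in> {0..T} \<Longrightarrow> f t x y \<ge> c t"
    and M2: "\<And>u u'. C1_with_deriv T u u' \<Longrightarrow> (INF t\<in>{0..T}. u' t) \<ge> M\<^sub>2 \<Longrightarrow>
           integral {0..T} (\<lambda>t. f t (u t) (u' t)) \<noteq> 0"
    and M1: "\<And>u u'. C1_with_deriv T u u' \<Longrightarrow> (SUP t\<in>{0..T}. u' t) \<le> M\<^sub>1 \<Longrightarrow>
           integral {0..T} (\<lambda>t. f t (u t) (u' t)) \<noteq> 0"
    and L: "L = max \<bar>\<phi> M\<^sub>2\<bar> \<bar>\<phi> M\<^sub>1\<bar>"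
    and r: "r = max \<bar>\<psi> (L + 2 * L1_norm T (\<lambda>t. neg_part (c t)))\<bar>
                 \<bar>\<psi> (- L - 2 * L1_norm T (\<lambda>t. neg_part (c t)))\<bar>"
    and M_a: "- a \<le> M\<^sub>1" "M\<^sub>1 < M\<^sub>2" "M\<^sub>2 \<le> a" and "r \<le> a"
    and sign: "integral {0..T} (\<lambda>t. f t (a + a * t) a) * integral {0..T} (\<lambda>t. f t (- a + - a * t) (- a)) < 0"
  shows "\<exists>u u'. solves_phi_ode T \<phi> f u u' \<and> u' 0 = u 0 \<and> u' T = u' 0"
proof -
  have "a > 0"
    using M_a by linarith
  have \<phi>: "continuous_on UNIV \<phi>" and \<psi>: "continuous_on UNIV \<psi>"
    and \<psi>\<phi>: "\<And>x. \<psi> (\<phi> x) = x" and \<phi>\<psi>: "\<And>x. \<phi> (\<psi> x) = x"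
    using hom by (auto simp: homeomorphism_def)
  define cl :: "real \<Rightarrow> real \<Rightarrow> real" where "cl b x = max (- b) (min b x)" for b x
  have cl_cont: "continuous_on UNIV (cl b)" for b
    unfolding cl_def by (intro continuous_intros)
  have cl_id: "cl b x = x" if "\<bar>x\<bar> \<le> b" for b x
    using that by (auto simp: cl_def)
  have cl_le: "\<bar>cl b x\<bar> \<le> b" if "0 \<le> b" for b x
    using that by (auto simp: cl_def)
  \<comment> \<open>The single parameter \<open>\<sigma>\<close> in \<open>[-2a, 2a]\<close>
    describes the whole path: for modulus at most \<open>a\<close> the initial slope is
    \<open>\<sigma>\<close> and the factor is 1; beyond that the slope stays at \<open>a\<close> or
    \<open>-a\<close> while the factor falls linearly to 0.\<close>
  define \<mu> where "\<mu> \<sigma> = min 1 (2 - \<bar>\<sigma>\<bar> / a)" for \<sigma>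
  \<comment> \<open>Since \<open>snd x\<close> is the accumulated integral of \<open>f\<close>, this
    is the value that the equation with factor \<open>\<mu> \<sigma>\<close> prescribes for
    \<open>\<phi>(u')\<close>.\<close>
  define w where "w \<sigma> x = \<phi> (cl a \<sigma>) + \<mu> \<sigma> * snd x" for \<sigma> and x :: "real \<times> real"
  define y where "y \<sigma> x = cl a (\<psi> (w \<sigma> x))" for \<sigma> x
  \<comment> \<open>A function with initial value and slope at most \<open>a\<close> in modulus is
    bounded by \<open>R\<close> on \<open>[0, T]\<close>.\<close>
  define R where "R = a * (1 + T)"
  define F where "F \<sigma> t x = (y \<sigma> x, f t (cl R (fst x)) (y \<sigma> x))" for \<sigma> t x
  define z0 where "z0 \<sigma> = (cl a \<sigma>, 0::real)" for \<sigma>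
  define H where "H b = integral {0..T} (\<lambda>t. f t (b + b * t) b)" for b
  have [continuous_intros]: "continuous_on S (\<lambda>x. cl b (g x))" if "continuous_on S g" for S :: "'z::topological_space set" and b g
    by (rule continuous_on_compose2[OF cl_cont that]) simp
  have [continuous_intros]: "continuous_on S (\<lambda>x. \<phi> (g x))" if "continuous_on S g" for S :: "'z::topological_space set" and g
    by (rule continuous_on_compose2[OF \<phi> that]) simp
  have [continuous_intros]: "continuous_on S (\<lambda>x. \<psi> (g x))" if "continuous_on S g" for S :: "'z::topological_space set" and g
    by (rule continuous_on_compose2[OF \<psi> that]) simp
  have y_cont [continuous_intros]: "continuous_on S (\<lambda>x. y (g x) (h x))" if "continuous_on S g" "continuous_on S h"
    for S :: "'z::topological_space set" and g h
    unfolding y_def w_def \<mu>_def using \<open>a > 0\<close> by (intro continuous_intros that) auto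
  have F_cont: "continuous_on (S \<times> {0..T} \<times> UNIV) (\<lambda>(\<sigma>, t, x). F \<sigma> t x)" for S
  proof -
    have "continuous_on (S \<times> {0..T} \<times> UNIV)
        (\<lambda>p. (\<lambda>(t, x, y). f t x y) (fst (snd p), cl R (fst (snd (snd p))), y (fst p) (snd (snd p))))"
      by (intro continuous_on_compose2[OF f] continuous_intros) auto
    then show ?thesis
      unfolding F_def case_prod_unfold by (intro continuous_intros) auto
  qed
  have "compact ({0..T} \<times> cball (0::real) R \<times> cball (0::real) a)"
    by (intro compact_Times compact_Icc compact_cball)
  then have "bounded ((\<lambda>(t, x, y). f t x y) ` ({0..T} \<times> cball 0 R \<times> cball 0 a))"
    by (intro compact_imp_bounded compact_continuous_image) (auto intro: continuous_on_subset[OF f])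
  then obtain K where K: "\<And>t x y. t \<in> {0..T} \<Longrightarrow> x \<in> cball 0 R \<Longrightarrow> y \<in> cball 0 a \<Longrightarrow> \<bar>f t x y\<bar> \<le> K"
    by (fastforce simp: bounded_iff)
  have "0 \<le> R"
    using \<open>a > 0\<close> \<open>T > 0\<close> by (simp add: R_def)
  have F_bound: "norm (F \<sigma> t x) \<le> a + K" if "t \<in> {0..T}" for \<sigma> t x
    using norm_Pair_le[of "y \<sigma> x" "f t (cl R (fst x)) (y \<sigma> x)"] that
      K[OF that, of "cl R (fst x)" "y \<sigma> x"] cl_le[OF \<open>0 \<le> R\<close>, of "fst x"] cl_le[of a "\<psi> (w \<sigma> x)"] \<open>a > 0\<close>
    unfolding F_def y_def[symmetric] by simp
  \<comment> \<open>By the choice of \<open>R\<close>, the cutoff of the first component never acts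
    on a solution and disappears from the equations.\<close>
  have sol: "fst (z t) = cl a \<sigma> + integral {0..t} (\<lambda>s. y \<sigma> (z s))"
    "snd (z t) = integral {0..t} (\<lambda>s. f s (fst (z s)) (y \<sigma> (z s)))"
    if z: "continuous_on {0..T} z"
      and z_eq: "\<And>t. t \<in> {0..T} \<Longrightarrow> z t = z0 \<sigma> + integral {0..t} (\<lambda>s. F \<sigma> s (z s))"
      and t: "t \<in> {0..T}" for z \<sigma> t
  proof -
    have cont: "continuous_on {0..t} (\<lambda>s. y \<sigma> (z s))" "continuous_on {0..t} (\<lambda>s. f s (cl R (fst (z s))) (y \<sigma> (z s)))"
      if "t \<in> {0..T}" for t
    proof -
      have "continuous_on {0..t} z"
        using that by (intro continuous_on_subset[OF z]) auto
      then show "continuous_on {0..t} (\<lambda>s. y \<sigma> (z s))" "continuous_on {0..t} (\<lambda>s. f s (cl R (fst (z s))) (y \<sigma> (z s)))"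
        using that by (auto intro!: continuous_on_superposition[OF f] continuous_intros)
    qed
    have fst: "fst (z t) = cl a \<sigma> + integral {0..t} (\<lambda>s. y \<sigma> (z s))"
      and snd: "snd (z t) = integral {0..t} (\<lambda>s. f s (cl R (fst (z s))) (y \<sigma> (z s)))"
      if "t \<in> {0..T}" for t
      using pair_integral_equation[OF cont[OF that]] z_eq[OF that] unfolding z0_def F_def by auto
    have "\<bar>fst (z t)\<bar> \<le> R" if "t \<in> {0..T}" for t
    proof -
      have "norm (integral {0..t} (\<lambda>s. y \<sigma> (z s))) \<le> a * (t - 0)"
        using that cl_le \<open>a > 0\<close> cont(1)[OF that] by (intro integral_bound) (auto simp: y_def)
      moreover have "a * t \<le> a * T"
        using that \<open>a > 0\<close> by simp
      ultimately show ?thesis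
        using cl_le[OF less_imp_le[OF \<open>a > 0\<close>], of \<sigma>]
        unfolding fst[OF that] R_def distrib_left real_norm_def by simp
    qed
    then have "integral {0..t} (\<lambda>s. f s (cl R (fst (z s))) (y \<sigma> (z s))) =
        integral {0..t} (\<lambda>s. f s (fst (z s)) (y \<sigma> (z s)))"
      using t by (intro integral_cong) (auto simp: cl_id)
    then show "fst (z t) = cl a \<sigma> + integral {0..t} (\<lambda>s. y \<sigma> (z s))"
      "snd (z t) = integral {0..t} (\<lambda>s. f s (fst (z s)) (y \<sigma> (z s)))"
      using fst[OF t] snd[OF t] by auto
  qed
  \<comment> \<open>At both ends of the path the factor is 0, so the slope is constantly
    \<open>b\<close> and \<open>u\<close> is the affine function \<open>b + b t\<close>.\<close>
  have ends: "snd (z T) = H b"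
    if b: "\<sigma> = 2 * b" "\<bar>b\<bar> = a" and z: "continuous_on {0..T} z"
      and z_eq: "\<And>t. t \<in> {0..T} \<Longrightarrow> z t = z0 \<sigma> + integral {0..t} (\<lambda>s. F \<sigma> s (z s))" for z \<sigma> b
  proof -
    have "\<mu> \<sigma> = 0" "cl a \<sigma> = b"
      using b \<open>a > 0\<close> by (auto simp: \<mu>_def abs_mult cl_def)
    then have y: "y \<sigma> x = b" for x
      using b(2) by (simp add: y_def w_def \<psi>\<phi> cl_id)
    have "fst (z t) = b + b * t" if "t \<in> {0..T}" for t
      using sol(1)[OF z z_eq that] that \<open>cl a \<sigma> = b\<close> by (simp add: y)
    then show ?thesis
      using sol(2)[OF z z_eq, of T] \<open>T > 0\<close> by (auto simp: y H_def intro!: integral_cong)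
  qed
  \<comment> \<open>Normalises the orientation: the intermediate value argument expects a negative
    sign at \<open>-2a\<close> and a positive one at \<open>2a\<close>.\<close>
  define s where "s = sgn (H a)"
  have s: "s * H a > 0" "s * H (- a) < 0"
    using sign unfolding H_def[symmetric] s_def by (auto simp: sgn_if mult_less_0_iff)
  have E: "continuous_on UNIV (\<lambda>x::real \<times> real. s * snd x)" and z0: "continuous_on {- 2 * a..2 * a} z0"
    unfolding z0_def by (intro continuous_intros)+
  have pq: "- 2 * a \<le> 2 * a"
    using \<open>a > 0\<close> by simp
  have "\<exists>\<sigma> z. \<sigma> \<in> {- 2 * a..2 * a} \<and> continuous_on {0..T} z \<and>
      (\<forall>t\<in>{0..T}. z t = z0 \<sigma> + integral {0..t} (\<lambda>s. F \<sigma> s (z s))) \<and> s * snd (z T) = 0"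
  proof (rule integral_equation_intermediate_value[where E = "\<lambda>x. s * snd x" and F = F and ?z0.0 = z0
        and T = T and p = "- 2 * a" and q = "2 * a", OF \<open>T > 0\<close> pq z0 F_cont F_bound E])
    show "s * snd (z T) < 0" if "continuous_on {0..T} z"
      and "\<And>t. t \<in> {0..T} \<Longrightarrow> z t = z0 (- 2 * a) + integral {0..t} (\<lambda>s. F (- 2 * a) s (z s))" for z
      using ends[OF _ _ that, of "- a"] s \<open>a > 0\<close> by simp
    show "s * snd (z T) > 0" if "continuous_on {0..T} z"
      and "\<And>t. t \<in> {0..T} \<Longrightarrow> z t = z0 (2 * a) + integral {0..t} (\<lambda>s. F (2 * a) s (z s))" for z
      using ends[OF _ _ that, of a] s \<open>a > 0\<close> by simp
  qed (assumption, blast)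
  then obtain \<sigma> z where \<sigma>: "\<sigma> \<in> {- 2 * a..2 * a}" and z: "continuous_on {0..T} z"
    and z_eq: "\<And>t. t \<in> {0..T} \<Longrightarrow> z t = z0 \<sigma> + integral {0..t} (\<lambda>s. F \<sigma> s (z s))"
    and E_0: "s * snd (z T) = 0"
    by blast
  have zT: "snd (z T) = 0"
    using E_0 s by auto
  define u' where "u' t = y \<sigma> (z t)" for t
  have u'_cont: "continuous_on {0..T} u'"
    unfolding u'_def by (intro continuous_intros z)
  have u: "C1_with_deriv T (\<lambda>t. fst (z t)) u'"
    using sol(1)[OF z z_eq] by (intro C1_with_deriv_primitive[OF u'_cont, of _ "cl a \<sigma>"]) (auto simp: u'_def[abs_def])
  have \<mu>: "0 \<le> \<mu> \<sigma>" "\<mu> \<sigma> \<le> 1"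
    using \<sigma> \<open>a > 0\<close> by (auto simp: \<mu>_def field_simps abs_le_iff)
  have bound: "\<bar>\<psi> (w \<sigma> (z t))\<bar> < r" if "t \<in> {0..T}" for t
  proof (rule a_priori_bound[OF \<open>T > 0\<close> hom f c fc M2 M1 L r M_a \<mu> u _ _ _ that])
    show "integral {0..T} (\<lambda>t. f t (fst (z t)) (u' t)) = 0"
      using sol(2)[OF z z_eq, of T] \<open>T > 0\<close> zT by (simp add: u'_def)
    show "w \<sigma> (z t) = \<phi> (cl a \<sigma>) + \<mu> \<sigma> * integral {0..t} (\<lambda>s. f s (fst (z s)) (u' s))"
      if "t \<in> {0..T}" for t
      using sol(2)[OF z z_eq that] by (simp add: w_def u'_def)
    show "u' t = max (- a) (min a (\<psi> (w \<sigma> (z t))))" for t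
      by (simp add: u'_def y_def cl_def)
  qed
  have u'_eq: "u' t = \<psi> (w \<sigma> (z t))" if "t \<in> {0..T}" for t
    using bound[OF that] \<open>r \<le> a\<close> by (simp add: u'_def y_def cl_id)
  have z_0: "z 0 = (cl a \<sigma>, 0)"
    using z_eq[of 0] \<open>T > 0\<close> by (simp add: z0_def)
  then have u'_0: "u' 0 = cl a \<sigma>"
    using u'_eq[of 0] \<open>T > 0\<close> by (simp add: w_def \<psi>\<phi>)
  \<comment> \<open>The a priori bound is strict at \<open>t = 0\<close>, so the initial slope is
    neither \<open>a\<close> nor \<open>-a\<close> and \<open>\<sigma>\<close> lies on the piece of
    the path with factor 1.\<close>
  have "\<bar>cl a \<sigma>\<bar> < a"
    using bound[of 0] u'_eq[of 0] u'_0 \<open>T > 0\<close> \<open>r \<le> a\<close> by simp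
  then have "\<bar>\<sigma>\<bar> < a"
    by (auto simp: cl_def max_def min_def split: if_splits)
  then have "\<mu> \<sigma> = 1"
    using \<open>a > 0\<close> by (simp add: \<mu>_def field_simps min_def)
  have f_cont: "continuous_on {0..T} (\<lambda>t. f t (fst (z t)) (u' t))"
    by (intro continuous_on_superposition[OF f] continuous_intros z u'_cont) simp
  have "C1_with_deriv T (\<lambda>t. \<phi> (u' t)) (\<lambda>t. f t (fst (z t)) (u' t))"
  proof (rule C1_with_deriv_primitive[OF f_cont])
    show "\<phi> (u' t) = \<phi> (cl a \<sigma>) + integral {0..t} (\<lambda>t. f t (fst (z t)) (u' t))" if "t \<in> {0..T}" for t
      unfolding u'_eq[OF that] \<phi>\<psi> w_def using sol(2)[OF z z_eq that] \<open>\<mu> \<sigma> = 1\<close> by (simp add: u'_def)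
  qed
  then have "solves_phi_ode T \<phi> f (\<lambda>t. fst (z t)) u'"
    unfolding solves_phi_ode_def using u by blast
  moreover have "u' 0 = fst (z 0)"
    using z_0 u'_0 by simp
  moreover have "u' T = u' 0"
    using u'_eq[of T] u'_eq[of 0] \<open>T > 0\<close> zT z_0 by (simp add: w_def)
  ultimately show ?thesis
    by blast
qed

section \<open>Signed zeros of planar maps\<close>

text \<open>The difference of two continuous logarithms takes values in the discrete set of
  multiples of \<open>2 * pi * \<i>\<close>, hence is constant on a connected set. The common
  increment serves as a winding number.\<close>

lemma continuous_log_unique:
  fixes h k :: "'a::topological_space \<Rightarrow> complex"
  assumes "connected S" "continuous_on S h" "continuous_on S k"
    and eq: "\<And>x. x \<in> S \<Longrightarrow> exp (h x) = exp (k x)"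
    and "x \<in> S" "y \<in> S"
  shows "h y - h x = k y - k x"
proof -
  have "(\<lambda>x. h x - k x) constant_on S"
  proof (rule continuous_discrete_range_constant[OF \<open>connected S\<close>])
    show "continuous_on S (\<lambda>x. h x - k x)"
      by (intro continuous_intros assms)
    show "\<exists>e>0. \<forall>y. y \<in> S \<and> h y - k y \<noteq> h x - k x \<longrightarrow> e \<le> norm (h y - k y - (h x - k x))"
      if "x \<in> S" for x
    proof (intro exI[of _ "2 * pi"] conjI allI impI)
      fix y assume y: "y \<in> S \<and> h y - k y \<noteq> h x - k x"
      let ?d = "h y - k y - (h x - k x)"
      have "exp ?d = 1"
        using eq[of x] eq[of y] y that by (simp add: exp_diff)
      then obtain n :: int where n: "Re ?d = 0" "Im ?d = of_int (2 * n) * pi"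
        unfolding exp_eq_1 by blast
      moreover have "?d \<noteq> 0"
        using y by simp
      ultimately have "n \<noteq> 0"
        by (metis complex_eq_iff mult_zero_left mult_zero_right of_int_0 zero_complex.sel)
      then have "2 * pi * 1 \<le> 2 * pi * \<bar>real_of_int n\<bar>"
        by (intro mult_left_mono) auto
      also have "\<dots> = \<bar>Im ?d\<bar>"
        unfolding n(2) by (simp add: abs_mult)
      finally show "2 * pi \<le> norm ?d"
        using abs_Im_le_cmod[of ?d] by simp
    qed simp
  qed
  then obtain c where c: "\<And>x. x \<in> S \<Longrightarrow> h x - k x = c"
    unfolding constant_on_def by blast
  then have "h x - k x = h y - k y"
    using assms(5,6) by simp
  then show ?thesis
    by (simp add: algebra_simps)
qed

text \<open>The model of a zero of index 1, or of index -1 after conjugation.\<close>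

definition zero_factor :: "bool \<Rightarrow> complex \<Rightarrow> complex"
  where "zero_factor s h = (if s then h else cnj h)"

lemma zero_factor_eq_0_iff [simp]: "zero_factor s h = 0 \<longleftrightarrow> h = 0"
  by (simp add: zero_factor_def)

lemma norm_zero_factor [simp]: "norm (zero_factor s h) = norm h"
  by (simp add: zero_factor_def)

lemma continuous_on_zero_factor [continuous_intros]:
  "continuous_on S f \<Longrightarrow> continuous_on S (\<lambda>x. zero_factor s (f x))"
  by (cases s) (auto simp: zero_factor_def intro: continuous_intros)

text \<open>The punctured ball is not simply connected, so the existence of the exponent
  \<open>m\<close> fixes the index at \<open>x\<close> as 1 or -1. No derivative occurs, so the
  notion still applies after \<open>q\<close> has been modified by merely continuous
  functions.\<close>

definition simple_zero :: "(complex \<Rightarrow> complex) \<Rightarrow> complex \<Rightarrow> bool \<Rightarrow> bool"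
  where "simple_zero q x s \<longleftrightarrow>
    (\<exists>e>0. \<exists>m. continuous_on (ball x e - {x}) m \<and>
      (\<forall>z\<in>ball x e - {x}. q z = zero_factor s (z - x) * exp (m z)))"

text \<open>The quotient of \<open>q\<close> by its model stays within distance 1 of 1, hence in the
  right half plane, where the principal logarithm is continuous.\<close>

lemma simple_zero_I:
  assumes "0 < e" and q: "continuous_on (ball x e - {x}) q" and "\<kappa> \<noteq> 0"
    and close: "\<And>z. z \<in> ball x e - {x} \<Longrightarrow> norm (q z - \<kappa> * zero_factor s (z - x)) < norm \<kappa> * norm (z - x)"
  shows "simple_zero q x s"
proof -
  define w where "w z = q z / (\<kappa> * zero_factor s (z - x))" for z
  have "w z \<notin> \<real>\<^sub>\<le>\<^sub>0" "w z \<noteq> 0" if z: "z \<in> ball x e - {x}" for z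
  proof -
    have "w z - 1 = (q z - \<kappa> * zero_factor s (z - x)) / (\<kappa> * zero_factor s (z - x))"
      using z \<open>\<kappa> \<noteq> 0\<close> by (simp add: w_def field_simps)
    then have "norm (w z - 1) < 1"
      using close[OF z] z \<open>\<kappa> \<noteq> 0\<close> by (simp add: norm_divide norm_mult)
    then have "0 < Re (w z)"
      using abs_Re_le_cmod[of "w z - 1"] by auto
    then show "w z \<notin> \<real>\<^sub>\<le>\<^sub>0" "w z \<noteq> 0"
      by (auto simp: complex_nonpos_Reals_iff)
  qed
  note w = this
  have "continuous_on (ball x e - {x}) (\<lambda>z. Ln (w z) + Ln \<kappa>)"
    using w(1) \<open>\<kappa> \<noteq> 0\<close> by (auto simp: w_def intro!: continuous_intros q)
  moreover have "q z = zero_factor s (z - x) * exp (Ln (w z) + Ln \<kappa>)" if "z \<in> ball x e - {x}" for z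
    using w(2)[OF that] that \<open>\<kappa> \<noteq> 0\<close> by (simp add: exp_add) (simp add: w_def)
  ultimately show ?thesis
    unfolding simple_zero_def using \<open>0 < e\<close> by blast
qed

text \<open>In the real linear map \<open>\<alpha> * h + \<beta> * cnj h\<close> the coefficient of
  larger modulus dominates and decides between the holomorphic and the conjugated model.\<close>

lemma simple_zero_derivative:
  assumes der: "(q has_derivative (\<lambda>h. \<alpha> * h + \<beta> * cnj h)) (at x)" and "q x = 0"
    and q: "open U" "x \<in> U" "continuous_on U q" and "norm \<alpha> \<noteq> norm \<beta>"
  shows "simple_zero q x (norm \<beta> < norm \<alpha>)"
proof -
  define s where "s \<longleftrightarrow> norm \<beta> < norm \<alpha>"
  obtain \<kappa> \<kappa>' where \<kappa>: "norm \<kappa>' < norm \<kappa>"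
    and D: "\<And>h. \<alpha> * h + \<beta> * cnj h = \<kappa> * zero_factor s h + \<kappa>' * zero_factor (\<not> s) h"
  proof (cases s)
    case True
    then show ?thesis using that[of \<beta> \<alpha>] by (simp add: s_def zero_factor_def)
  next
    case False
    then show ?thesis using that[of \<alpha> \<beta>] assms(6) by (simp add: s_def zero_factor_def)
  qed
  \<comment> \<open>Half of the gap: the linearisation error and the smaller term together stay
    strictly below the dominant term.\<close>
  define \<epsilon> where "\<epsilon> = (norm \<kappa> - norm \<kappa>') / 2"
  have "0 < \<epsilon>"
    using \<kappa> by (simp add: \<epsilon>_def)
  then obtain d where "0 < d" and d: "\<And>z. norm (z - x) < d \<Longrightarrow>
      norm (q z - (\<alpha> * (z - x) + \<beta> * cnj (z - x))) \<le> \<epsilon> * norm (z - x)"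
    using der \<open>q x = 0\<close> unfolding has_derivative_at_alt by (metis diff_zero)
  obtain d' where "0 < d'" "ball x d' \<subseteq> U"
    using q openE by blast
  show ?thesis
    unfolding s_def[symmetric]
  proof (rule simple_zero_I[of "min d d'" _ _ \<kappa>])
    show "0 < min d d'" "\<kappa> \<noteq> 0"
      using \<open>0 < d\<close> \<open>0 < d'\<close> \<kappa> by auto
    show "continuous_on (ball x (min d d') - {x}) q"
      using \<open>ball x d' \<subseteq> U\<close> by (intro continuous_on_subset[OF q(3)]) auto
    show "norm (q z - \<kappa> * zero_factor s (z - x)) < norm \<kappa> * norm (z - x)"
      if "z \<in> ball x (min d d') - {x}" for z
    proof -
      have "norm (z - x) < d" "0 < norm (z - x)"
        using that by (auto simp: dist_norm norm_minus_commute)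
      have eq: "q z - \<kappa> * zero_factor s (z - x) = q z - (\<alpha> * (z - x) + \<beta> * cnj (z - x)) + \<kappa>' * zero_factor (\<not> s) (z - x)"
        unfolding D by simp
      have "norm (q z - \<kappa> * zero_factor s (z - x)) \<le> \<epsilon> * norm (z - x) + norm \<kappa>' * norm (z - x)"
        unfolding eq by (rule norm_triangle_mono[OF d[OF \<open>norm (z - x) < d\<close>]]) (simp add: norm_mult)
      also have "\<dots> = (\<epsilon> + norm \<kappa>') * norm (z - x)"
        by (simp add: algebra_simps)
      also have "\<dots> < norm \<kappa> * norm (z - x)"
        using \<kappa> \<open>0 < norm (z - x)\<close> by (intro mult_strict_right_mono) (auto simp: \<epsilon>_def field_simps)
      finally show ?thesis .
    qed
  qed
qed

text \<open>The zeros are divided out one by one, each time changing the quotient only in a small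
  disc inside \<open>S\<close>; what remains has no zero on the convex set \<open>S\<close> and
  therefore a logarithm. The formula is claimed only on the boundary, which these discs do not
  meet.\<close>

lemma factor_simple_zeros:
  assumes "finite Z" "convex S" "continuous_on S q" "Z \<subseteq> interior S"
    and "\<And>z. z \<in> S \<Longrightarrow> q z = 0 \<longleftrightarrow> z \<in> Z"
    and "\<And>x. x \<in> Z \<Longrightarrow> simple_zero q x (s x)"
  obtains m where "continuous_on S m"
    and "\<And>z. z \<in> S - interior S \<Longrightarrow> q z = exp (m z) * (\<Prod>x\<in>Z. zero_factor (s x) (z - x))"
  using assms(1,3-6)
proof (induction Z arbitrary: q thesis rule: finite_induct)
  case empty
  then obtain m where "continuous_on S m" "\<And>z. z \<in> S \<Longrightarrow> q z = exp (m z)"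
    using continuous_logarithm_on_contractible[of S q] convex_imp_contractible[OF \<open>convex S\<close>] by auto
  then show ?case
    using empty.prems(1) by auto
next
  case (insert x Z)
  let ?fac = "\<lambda>z. zero_factor (s x) (z - x)"
  obtain e m0 where "0 < e" and m0: "continuous_on (ball x e - {x}) m0"
    and q_m0: "\<And>z. z \<in> ball x e - {x} \<Longrightarrow> q z = ?fac z * exp (m0 z)"
    using insert.prems(5)[of x] unfolding simple_zero_def by auto
  \<comment> \<open>The disc has to miss the boundary of \<open>S\<close> and the other zeros, and
    to stay where the local logarithm \<open>m0\<close> is defined.\<close>
  have "open (interior S \<inter> - Z \<inter> ball x e)" "x \<in> interior S \<inter> - Z \<inter> ball x e"
    using insert.hyps insert.prems(3) \<open>0 < e\<close> by (auto intro!: finite_imp_closed open_Int)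
  then obtain \<delta> where "0 < \<delta>" and \<delta>: "cball x \<delta> \<subseteq> interior S \<inter> - Z \<inter> ball x e"
    by (meson open_contains_cball)
  have "continuous_on (sphere x \<delta>) m0"
    using \<delta> \<open>0 < \<delta>\<close> by (intro continuous_on_subset[OF m0]) auto
  then obtain m1 where m1: "continuous_on UNIV m1" "\<And>z. z \<in> sphere x \<delta> \<Longrightarrow> m1 z = m0 z"
    by (rule Tietze_unbounded[of "sphere x \<delta>" m0 UNIV]) auto
  text \<open>The zero at \<open>x\<close> is removed by extending the logarithm from the circle to the disc.\<close>
  define q1 where "q1 z = (if z \<in> cball x \<delta> then exp (m1 z) else q z / ?fac z)" for z
  have "continuous_on (S \<inter> cball x \<delta> \<union> (S - ball x \<delta>)) q1"
    unfolding q1_def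
  proof (rule continuous_on_cases_local)
    show "closedin (top_of_set (S \<inter> cball x \<delta> \<union> (S - ball x \<delta>))) (S \<inter> cball x \<delta>)"
      unfolding closedin_closed by (intro exI[of _ "cball x \<delta>"]) auto
    show "closedin (top_of_set (S \<inter> cball x \<delta> \<union> (S - ball x \<delta>))) (S - ball x \<delta>)"
      unfolding closedin_closed by (intro exI[of _ "- ball x \<delta>"]) auto
    show "continuous_on (S \<inter> cball x \<delta>) (\<lambda>z. exp (m1 z))"
      by (intro continuous_intros continuous_on_subset[OF m1(1)]) auto
    show "continuous_on (S - ball x \<delta>) (\<lambda>z. q z / ?fac z)"
      using \<open>0 < \<delta>\<close> by (intro continuous_intros continuous_on_subset[OF insert.prems(2)]) auto
    fix z assume "z \<in> S \<inter> cball x \<delta> \<and> z \<notin> cball x \<delta> \<or> z \<in> S - ball x \<delta> \<and> z \<in> cball x \<delta>"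
    then have z: "z \<in> sphere x \<delta>"
      by auto
    then have "z \<in> ball x e - {x}"
      using \<delta> \<open>0 < \<delta>\<close> by auto
    then show "exp (m1 z) = q z / ?fac z"
      using q_m0[of z] m1(2)[OF z] by simp
  qed
  moreover have "S \<inter> cball x \<delta> \<union> (S - ball x \<delta>) = S"
    by auto
  ultimately have q1_cont: "continuous_on S q1"
    by simp
  have q1_0: "q1 z = 0 \<longleftrightarrow> z \<in> Z" if "z \<in> S" for z
    using \<delta> \<open>0 < \<delta>\<close> insert.prems(4)[OF that] insert.hyps by (auto simp: q1_def)
  have q1_simple: "simple_zero q1 y (s y)" if y: "y \<in> Z" for y
  proof -
    obtain e' m where "0 < e'" and m: "continuous_on (ball y e' - {y}) m"
      and q_m: "\<And>z. z \<in> ball y e' - {y} \<Longrightarrow> q z = zero_factor (s y) (z - y) * exp (m z)"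
      using insert.prems(5)[OF insertI2[OF y]] unfolding simple_zero_def by blast
    have "open (ball y e' - cball x \<delta>)" "y \<in> ball y e' - cball x \<delta>"
      using \<delta> \<open>0 < e'\<close> y by auto
    then obtain d where "0 < d" and d: "ball y d \<subseteq> ball y e' - cball x \<delta>"
      by (meson openE)
    have ne: "?fac z \<noteq> 0" if "z \<in> ball y d" for z
      using d that \<open>0 < \<delta>\<close> by auto
    \<comment> \<open>Near another zero \<open>y\<close> the divided factor does not vanish, so its
      logarithm is absorbed into the exponent and the index at \<open>y\<close> is
      unchanged.\<close>
    obtain k where k: "continuous_on (ball y d) k" "\<And>z. z \<in> ball y d \<Longrightarrow> ?fac z = exp (k z)"
      by (rule continuous_logarithm_on_ball[of y d ?fac]) (use ne in \<open>auto intro!: continuous_intros\<close>)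
    have "continuous_on (ball y d - {y}) (\<lambda>z. m z - k z)"
      using d by (intro continuous_intros continuous_on_subset[OF m] continuous_on_subset[OF k(1)]) auto
    moreover have "q1 z = zero_factor (s y) (z - y) * exp (m z - k z)" if "z \<in> ball y d - {y}" for z
      using that d k(2)[of z] q_m[of z] by (auto simp: q1_def exp_diff)
    ultimately show ?thesis
      unfolding simple_zero_def using \<open>0 < d\<close> by blast
  qed
  obtain m where m: "continuous_on S m"
    "\<And>z. z \<in> S - interior S \<Longrightarrow> q1 z = exp (m z) * (\<Prod>x\<in>Z. zero_factor (s x) (z - x))"
    by (rule insert.IH[OF _ q1_cont _ q1_0 q1_simple]) (use insert.prems(3) in auto)
  show ?case
  proof (rule insert.prems(1)[OF m(1)])
    fix z assume z: "z \<in> S - interior S"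
    then have "z \<notin> cball x \<delta>"
      using \<delta> by blast
    moreover from this have "z \<noteq> x"
      using \<open>0 < \<delta>\<close> by auto
    ultimately have "q z = q1 z * ?fac z"
      by (simp add: q1_def)
    then show "q z = exp (m z) * (\<Prod>x\<in>insert x Z. zero_factor (s x) (z - x))"
      using m(2)[OF z] insert.hyps by (simp add: mult_ac)
  qed
qed

text \<open>Contracting \<open>x\<close> to 0 along a segment that the curve misses gives a homotopy
  on a rectangle, which carries a continuous logarithm \<open>K\<close>. At
  \<open>\<tau> = 0\<close> its increment is that of \<open>ln R + \<i> \<theta>\<close>, and the
  homotopy preserves it.\<close>

lemma log_around_inside:
  fixes R :: "real \<Rightarrow> real"
  assumes R: "continuous_on {0..2*pi} R" "\<And>\<theta>. \<theta> \<in> {0..2*pi} \<Longrightarrow> 0 < R \<theta>" "R (2*pi) = R 0"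
    and x: "\<And>\<theta> \<tau>. \<theta> \<in> {0..2*pi} \<Longrightarrow> \<tau> \<in> {0..1} \<Longrightarrow> R \<theta> * cis \<theta> \<noteq> of_real \<tau> * x"
  obtains k where "continuous_on {0..2*pi} k" "k (2*pi) - k 0 = 2 * pi * \<i>"
    "\<And>\<theta>. \<theta> \<in> {0..2*pi} \<Longrightarrow> R \<theta> * cis \<theta> - x = exp (k \<theta>)"
proof -
  let ?Q = "{0..1::real} \<times> {0..2*pi}"
  have "continuous_on ?Q (\<lambda>p. R (snd p))"
    by (intro continuous_on_compose2[OF R(1)] continuous_intros) auto
  then have "continuous_on ?Q (\<lambda>p. R (snd p) * cis (snd p) - of_real (fst p) * x)"
    by (intro continuous_intros)
  then obtain K where K: "continuous_on ?Q K"
    and K_eq: "\<And>p. p \<in> ?Q \<Longrightarrow> R (snd p) * cis (snd p) - of_real (fst p) * x = exp (K p)"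
    by (rule continuous_logarithm_on_contractible) (use x in \<open>auto intro!: convex_imp_contractible convex_Times\<close>)
  have K_\<theta>: "continuous_on {0..2*pi} (\<lambda>\<theta>. K (\<tau>, \<theta>))" if "\<tau> \<in> {0..1}" for \<tau>
    using that by (intro continuous_on_compose2[OF K] continuous_intros) auto
  have K_\<tau>: "continuous_on {0..1} (\<lambda>\<tau>. K (\<tau>, \<theta>))" if "\<theta> \<in> {0..2*pi}" for \<theta>
    using that by (intro continuous_on_compose2[OF K] continuous_intros) auto
  \<comment> \<open>The curve is closed, so the edges \<open>\<theta> = 0\<close> and
    \<open>\<theta> = 2*pi\<close> carry logarithms of the same function of
    \<open>\<tau>\<close>.\<close>
  have "K (1, 2*pi) - K (0, 2*pi) = K (1, 0) - K (0, 0)"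
  proof (rule continuous_log_unique[of "{0..1::real}" "\<lambda>\<tau>. K (\<tau>, 2*pi)" "\<lambda>\<tau>. K (\<tau>, 0)" 0 1])
    show "exp (K (\<tau>, 2*pi)) = exp (K (\<tau>, 0))" if "\<tau> \<in> {0..1}" for \<tau>
      using K_eq[of "(\<tau>, 2*pi)"] K_eq[of "(\<tau>, 0)"] that R(3) by (simp add: cis_2pi)
  qed (auto intro!: K_\<tau>)
  moreover have "K (0, 2*pi) - K (0, 0) = (of_real (ln (R (2*pi))) + \<i> * of_real (2*pi)) - (of_real (ln (R 0)) + \<i> * of_real 0)"
  proof (rule continuous_log_unique[of "{0..2*pi}" "\<lambda>\<theta>. K (0, \<theta>)" "\<lambda>\<theta>. of_real (ln (R \<theta>)) + \<i> * of_real \<theta>" 0 "2*pi"])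
    show "continuous_on {0..2*pi} (\<lambda>\<theta>. complex_of_real (ln (R \<theta>)) + \<i> * of_real \<theta>)"
      using R(2) by (intro continuous_intros R(1)) (auto simp: less_imp_neq[THEN not_sym])
    show "exp (K (0, \<theta>)) = exp (complex_of_real (ln (R \<theta>)) + \<i> * of_real \<theta>)" if "\<theta> \<in> {0..2*pi}" for \<theta>
      using K_eq[of "(0, \<theta>)"] that R(2)[OF that]
      by (simp add: exp_add cis_conv_exp exp_of_real)
  qed (auto intro!: K_\<theta>)
  ultimately have "K (1, 2*pi) - K (1, 0) = 2 * pi * \<i>"
    using R(3) by (simp add: algebra_simps)
  moreover have "R \<theta> * cis \<theta> - x = exp (K (1, \<theta>))" if "\<theta> \<in> {0..2*pi}" for \<theta>
    using K_eq[of "(1, \<theta>)"] that by simp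
  ultimately show ?thesis
    using that[of "\<lambda>\<theta>. K (1, \<theta>)"] K_\<theta>[of 1] by simp
qed

text \<open>Along the closed boundary curve \<open>\<gamma>\<close>, each zero contributes its sign
  times \<open>2 * pi * \<i>\<close> to the increment of the logarithm of \<open>q\<close>. As
  \<open>q\<close> has a logarithm on the boundary itself, the total increment is 0.\<close>

lemma sum_signs_simple_zeros_eq_0:
  fixes R :: "real \<Rightarrow> real"
  assumes Z: "finite Z" "Z \<subseteq> interior S" and S: "convex S" "0 \<in> interior S"
    and q: "continuous_on S q" "\<And>z. z \<in> S \<Longrightarrow> q z = 0 \<longleftrightarrow> z \<in> Z"
    and s: "\<And>x. x \<in> Z \<Longrightarrow> simple_zero q x (s x)"
    and l: "continuous_on (S - interior S) l" "\<And>z. z \<in> S - interior S \<Longrightarrow> q z = exp (l z)"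
    and R: "continuous_on {0..2*pi} R" "\<And>\<theta>. \<theta> \<in> {0..2*pi} \<Longrightarrow> 0 < R \<theta>" "R (2*pi) = R 0"
    and \<gamma>: "\<And>\<theta>. \<theta> \<in> {0..2*pi} \<Longrightarrow> R \<theta> * cis \<theta> \<in> S - interior S"
  shows "(\<Sum>x\<in>Z. if s x then 1 else - 1 :: real) = 0"
proof -
  define \<gamma> where "\<gamma> \<theta> = R \<theta> * cis \<theta>" for \<theta>
  have \<gamma>_in: "\<gamma> \<theta> \<in> S - interior S" if "\<theta> \<in> {0..2*pi}" for \<theta>
    using \<gamma> that by (simp add: \<gamma>_def)
  have \<gamma>_cont: "continuous_on {0..2*pi} \<gamma>"
    unfolding \<gamma>_def by (intro continuous_intros R)
  have \<gamma>_loop: "\<gamma> (2*pi) = \<gamma> 0"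
    by (simp add: \<gamma>_def R(3) cis_2pi)
  obtain m where m: "continuous_on S m"
    and q_m: "\<And>z. z \<in> S - interior S \<Longrightarrow> q z = exp (m z) * (\<Prod>x\<in>Z. zero_factor (s x) (z - x))"
    using factor_simple_zeros[OF Z(1) S(1) q(1) Z(2) q(2) s] by blast
  have "\<exists>k. continuous_on {0..2*pi} k \<and> k (2*pi) - k 0 = (if s x then 1 else - 1) * (2 * pi * \<i>) \<and>
      (\<forall>\<theta>\<in>{0..2*pi}. zero_factor (s x) (\<gamma> \<theta> - x) = exp (k \<theta>))" if "x \<in> Z" for x
  proof -
    \<comment> \<open>The segment from 0 to the zero lies in the convex interior, whereas
      \<open>\<gamma>\<close> runs on the boundary.\<close>
    have "of_real \<tau> * x \<in> interior S" if "\<tau> \<in> {0..1}" for \<tau>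
    proof -
      have "(1 - \<tau>) *\<^sub>R 0 + \<tau> *\<^sub>R x \<in> interior S"
        using convex_interior[OF S(1)] S(2) Z(2) \<open>x \<in> Z\<close> that by (intro convexD_alt) auto
      then show ?thesis
        by (simp add: scaleR_conv_of_real)
    qed
    then have "R \<theta> * cis \<theta> \<noteq> of_real \<tau> * x" if "\<theta> \<in> {0..2*pi}" "\<tau> \<in> {0..1}" for \<theta> \<tau>
      using \<gamma>[of \<theta>] that by (metis DiffD2)
    then obtain k where k: "continuous_on {0..2*pi} k" "k (2*pi) - k 0 = 2 * pi * \<i>"
      "\<And>\<theta>. \<theta> \<in> {0..2*pi} \<Longrightarrow> R \<theta> * cis \<theta> - x = exp (k \<theta>)"
      using log_around_inside[OF R] by metis
    show ?thesis
    proof (cases "s x")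
      case True
      then show ?thesis
        using k by (auto simp: zero_factor_def \<gamma>_def)
    next
      case False
      have "cnj (k (2*pi)) - cnj (k 0) = - (2 * pi * \<i>)"
        using arg_cong[OF k(2), of cnj] by simp
      moreover have "zero_factor (s x) (\<gamma> \<theta> - x) = exp (cnj (k \<theta>))" if "\<theta> \<in> {0..2*pi}" for \<theta>
        using arg_cong[OF k(3)[OF that], of cnj] False by (simp add: zero_factor_def \<gamma>_def exp_cnj)
      ultimately show ?thesis
        using k(1) False by (intro exI[of _ "\<lambda>\<theta>. cnj (k \<theta>)"]) (auto intro: continuous_intros)
    qed
  qed
  then obtain k where k: "\<And>x. x \<in> Z \<Longrightarrow> continuous_on {0..2*pi} (k x)"
    "\<And>x. x \<in> Z \<Longrightarrow> k x (2*pi) - k x 0 = (if s x then 1 else - 1) * (2 * pi * \<i>)"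
    "\<And>x \<theta>. x \<in> Z \<Longrightarrow> \<theta> \<in> {0..2*pi} \<Longrightarrow> zero_factor (s x) (\<gamma> \<theta> - x) = exp (k x \<theta>)"
    by metis
  \<comment> \<open>Both sides are increments of logarithms of the product of the factors along
    \<open>\<gamma>\<close>; the right one is evaluated through points of the curve and closes
    up.\<close>
  have "(\<Sum>x\<in>Z. k x (2*pi)) - (\<Sum>x\<in>Z. k x 0) =
      (l (\<gamma> (2*pi)) - m (\<gamma> (2*pi))) - (l (\<gamma> 0) - m (\<gamma> 0))"
  proof (rule continuous_log_unique[of "{0..2*pi}" "\<lambda>\<theta>. \<Sum>x\<in>Z. k x \<theta>" "\<lambda>\<theta>. l (\<gamma> \<theta>) - m (\<gamma> \<theta>)" 0 "2*pi"])
    show "continuous_on {0..2*pi} (\<lambda>\<theta>. \<Sum>x\<in>Z. k x \<theta>)"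
      by (intro continuous_intros k(1))
    show "continuous_on {0..2*pi} (\<lambda>\<theta>. l (\<gamma> \<theta>) - m (\<gamma> \<theta>))"
      using \<gamma>_in by (intro continuous_intros continuous_on_compose2[OF l(1) \<gamma>_cont] continuous_on_compose2[OF m \<gamma>_cont]) auto
    show "exp (\<Sum>x\<in>Z. k x \<theta>) = exp (l (\<gamma> \<theta>) - m (\<gamma> \<theta>))" if "\<theta> \<in> {0..2*pi}" for \<theta>
    proof -
      have "exp (\<Sum>x\<in>Z. k x \<theta>) = (\<Prod>x\<in>Z. zero_factor (s x) (\<gamma> \<theta> - x))"
        using Z(1) k(3) that by (simp add: exp_sum)
      moreover have "exp (l (\<gamma> \<theta>)) = exp (m (\<gamma> \<theta>)) * (\<Prod>x\<in>Z. zero_factor (s x) (\<gamma> \<theta> - x))"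
        using q_m[OF \<gamma>_in[OF that]] l(2)[OF \<gamma>_in[OF that]] by simp
      ultimately show ?thesis
        by (simp add: exp_diff)
    qed
  qed auto
  then have "(\<Sum>x\<in>Z. k x (2*pi) - k x 0) = 0"
    by (simp add: \<gamma>_loop sum_subtractf)
  then have "(\<Sum>x\<in>Z. (if s x then 1 else - 1) * (2 * pi * \<i>)) = 0"
    using k(2) by simp
  then have "(\<Sum>x\<in>Z. if s x then 1 else - 1 :: complex) = 0"
    by (simp flip: sum_distrib_right)
  moreover have "complex_of_real (\<Sum>x\<in>Z. if s x then 1 else - 1) = (\<Sum>x\<in>Z. if s x then 1 else - 1)"
    unfolding of_real_sum by (intro sum.cong) auto
  ultimately show ?thesis
    using of_real_eq_0_iff by metis
qed

section \<open>Vanishing of the Brouwer degree\<close>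

lemma real_polynomial_function_gradient:
  fixes p :: "'a::euclidean_space \<Rightarrow> real"
  assumes "real_polynomial_function p"
  shows "\<exists>D. continuous_on UNIV D \<and> (\<forall>x. (p has_derivative (\<lambda>h. D x \<bullet> h)) (at x))"
  using assms
proof induction
  case (linear f)
  \<comment> \<open>For a linear functional, \<open>adjoint f 1\<close> is its Riesz vector, hence
    the constant gradient.\<close>
  then have "f h = adjoint f 1 \<bullet> h" for h
    using adjoint_works[of f h 1] by (simp add: bounded_linear.linear inner_commute)
  then have "f = (\<lambda>h. adjoint f 1 \<bullet> h)"
    by blast
  then have "(f has_derivative (\<lambda>h. adjoint f 1 \<bullet> h)) (at x)" for x
    using bounded_linear.has_derivative[OF linear.hyps has_derivative_ident, of "at x"] by simp
  then show ?case
    by (intro exI[of _ "\<lambda>_. adjoint f 1"]) simp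
next
  case (const c)
  then show ?case
    by (intro exI[of _ "\<lambda>_. 0"]) simp
next
  case (add f g)
  obtain D where D: "continuous_on UNIV D" "\<And>x. (f has_derivative (\<lambda>h. D x \<bullet> h)) (at x)"
    using add.IH(1) by blast
  obtain E where E: "continuous_on UNIV E" "\<And>x. (g has_derivative (\<lambda>h. E x \<bullet> h)) (at x)"
    using add.IH(2) by blast
  show ?case
  proof (intro exI[of _ "\<lambda>x. D x + E x"] conjI allI)
    show "continuous_on UNIV (\<lambda>x. D x + E x)"
      by (intro continuous_intros D E)
    show "((\<lambda>x. f x + g x) has_derivative (\<lambda>h. (D x + E x) \<bullet> h)) (at x)" for x
      using has_derivative_add[OF D(2) E(2), of x] by (simp add: inner_add_left)
  qed
next
  case (mult f g)
  obtain D where D: "continuous_on UNIV D" "\<And>x. (f has_derivative (\<lambda>h. D x \<bullet> h)) (at x)"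
    using mult.IH(1) by blast
  obtain E where E: "continuous_on UNIV E" "\<And>x. (g has_derivative (\<lambda>h. E x \<bullet> h)) (at x)"
    using mult.IH(2) by blast
  have "continuous_on UNIV f" "continuous_on UNIV g"
    by (intro continuous_at_imp_continuous_on ballI has_derivative_continuous[OF D(2)]
        has_derivative_continuous[OF E(2)])+
  show ?case
  proof (intro exI[of _ "\<lambda>x. f x *\<^sub>R E x + g x *\<^sub>R D x"] conjI allI)
    show "continuous_on UNIV (\<lambda>x. f x *\<^sub>R E x + g x *\<^sub>R D x)"
      by (intro continuous_intros D E \<open>continuous_on UNIV f\<close> \<open>continuous_on UNIV g\<close>)
    show "((\<lambda>x. f x * g x) has_derivative (\<lambda>h. (f x *\<^sub>R E x + g x *\<^sub>R D x) \<bullet> h)) (at x)" for x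
      using has_derivative_mult[OF D(2) E(2), of x] by (simp add: inner_add_left mult_ac)
  qed
qed

lemma polynomial_function_jacobian:
  fixes p :: "real^'m \<Rightarrow> real^'n"
  assumes "polynomial_function p"
  obtains J where "continuous_on UNIV J" "\<And>x. (p has_derivative (\<lambda>h. J x *v h)) (at x)"
proof -
  have "real_polynomial_function (\<lambda>x. p x $ i)" for i
    using assms bounded_linear_vec_nth[of i] unfolding polynomial_function_def o_def by blast
  then have "\<exists>D. continuous_on UNIV D \<and> (\<forall>x. ((\<lambda>x. p x $ i) has_derivative (\<lambda>h. D x \<bullet> h)) (at x))" for i
    by (metis real_polynomial_function_gradient)
  then obtain D where D: "\<And>i. continuous_on UNIV (D i)"
    "\<And>i x. ((\<lambda>x. p x $ i) has_derivative (\<lambda>h. D i x \<bullet> h)) (at x)"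
    by metis
  show ?thesis
  proof
    show "continuous_on UNIV (\<lambda>x. \<chi> i. D i x)"
      by (intro continuous_intros D)
    show "(p has_derivative (\<lambda>h. (\<chi> i. D i x) *v h)) (at x)" for x
      unfolding has_derivative_componentwise_within[of p]
      using D(2) by (auto simp: Basis_vec_def inner_axis matrix_vector_mul_component)
  qed
qed

text \<open>Stone-Weierstrass gives a polynomial map near \<open>f\<close>. By Sard's theorem its
  critical values are negligible, so some \<open>v\<close> near \<open>y\<close> is not critical;
  translation by \<open>y - v\<close> makes \<open>y\<close> a regular value.\<close>

lemma regular_approximation_exists:
  fixes f :: "real^'n::{finite,wellorder} \<Rightarrow> real^'n::{finite,wellorder}"
  assumes "bounded \<Omega>" "\<Omega> \<noteq> {}" and f: "continuous_on (closure \<Omega>) f" and y: "y \<notin> f ` frontier \<Omega>"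
  obtains g J where "regular_approximation f \<Omega> y g J"
proof -
  have "compact (closure \<Omega>)" "compact (frontier \<Omega>)"
    using \<open>bounded \<Omega>\<close> by (auto simp: compact_frontier_bounded)
  then have "closed (f ` frontier \<Omega>)"
    using f by (intro compact_imp_closed compact_continuous_image) (auto intro: continuous_on_subset simp: frontier_def)
  \<comment> \<open>The distance \<open>infdist\<close> to the empty set is 0 by convention, so a
    nonempty frontier matters for positivity.\<close>
  moreover have "frontier \<Omega> \<noteq> {}"
    using \<open>\<Omega> \<noteq> {}\<close> \<open>bounded \<Omega>\<close> not_bounded_UNIV by (auto simp: frontier_eq_empty)
  ultimately have pos: "0 < infdist y (f ` frontier \<Omega>)"
    using y by (intro infdist_pos_not_in_closed) auto
  \<comment> \<open>One half of the admissible distance is spent on the approximation, the other on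
    the translation.\<close>
  define \<epsilon> where "\<epsilon> = infdist y (f ` frontier \<Omega>) / 2"
  obtain p where p: "polynomial_function p" "\<And>x. x \<in> closure \<Omega> \<Longrightarrow> norm (f x - p x) < \<epsilon>"
    using Stone_Weierstrass_polynomial_function[OF \<open>compact (closure \<Omega>)\<close> f, of \<epsilon>] pos by (auto simp: \<epsilon>_def)
  obtain J where J: "continuous_on UNIV J" "\<And>x. (p has_derivative (\<lambda>h. J x *v h)) (at x)"
    using polynomial_function_jacobian[OF p(1)] by blast
  have "negligible (p ` {x. det (J x) = 0})"
  proof (rule baby_Sard)
    show "(p has_derivative (\<lambda>h. J x *v h)) (at x within {x. det (J x) = 0})" for x
      using J(2) by (rule has_derivative_at_withinI)
    show "rank (matrix (\<lambda>h. J x *v h)) < CARD('n)" if "x \<in> {x. det (J x) = 0}" for x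
      using that by (simp add: det_eq_0_rank matrix_of_matrix_vector_mul)
  qed simp
  then have "\<not> ball y \<epsilon> \<subseteq> p ` {x. det (J x) = 0}"
    using open_not_negligible[of "ball y \<epsilon>"] pos by (auto simp: \<epsilon>_def intro: negligible_subset)
  then obtain v where v: "dist y v < \<epsilon>" "v \<notin> p ` {x. det (J x) = 0}"
    by (meson mem_ball subsetI)
  have "regular_approximation f \<Omega> y (\<lambda>x. p x + (y - v)) J"
    unfolding regular_approximation_def
  proof (intro conjI ballI impI)
    have "continuous_on UNIV p"
      by (intro continuous_at_imp_continuous_on ballI has_derivative_continuous[OF J(2)])
    then show "continuous_on (closure \<Omega>) (\<lambda>x. p x + (y - v))"
      by (intro continuous_intros) (auto intro: continuous_on_subset)
    show "((\<lambda>x. p x + (y - v)) has_derivative (\<lambda>h. J x *v h)) (at x)" for x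
      using has_derivative_add_const[OF J(2)] .
    show "continuous_on \<Omega> J"
      using J(1) by (rule continuous_on_subset) simp
    show "det (J x) \<noteq> 0" if "p x + (y - v) = y" for x
      using that v(2) by force
    show "dist (p x + (y - v)) (f x) < infdist y (f ` frontier \<Omega>)" if "x \<in> closure \<Omega>" for x
    proof -
      have eq: "p x + (y - v) - f x = (y - v) - (f x - p x)"
        by simp
      have "dist (p x + (y - v)) (f x) \<le> dist y v + norm (f x - p x)"
        unfolding dist_norm eq by (rule norm_triangle_ineq4)
      then show ?thesis
        using v(1) p(2)[OF that] by (simp add: \<epsilon>_def)
    qed
  qed
  then show ?thesis
    by (rule that)
qed

section \<open>The plane as the complex numbers\<close>

definition complex_of_vec :: "real^2 \<Rightarrow> complex"
  where "complex_of_vec v = Complex (v$1) (v$2)"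

definition vec_of_complex :: "complex \<Rightarrow> real^2"
  where "vec_of_complex z = vector [Re z, Im z]"

lemma complex_of_vec_of_complex [simp]: "complex_of_vec (vec_of_complex z) = z"
  by (simp add: complex_of_vec_def vec_of_complex_def)

lemma vec_of_complex_of_vec [simp]: "vec_of_complex (complex_of_vec v) = v"
  by (simp add: complex_of_vec_def vec_of_complex_def vec_eq_iff forall_2)

lemma norm_complex_of_vec [simp]: "norm (complex_of_vec v) = norm v"
  by (simp add: complex_of_vec_def cmod_def norm_vec_def L2_set_def UNIV_2)

lemma bounded_linear_complex_of_vec: "bounded_linear complex_of_vec"
  by (rule bounded_linear_intro[of _ 1]) (auto simp: complex_of_vec_def complex_eq_iff norm_complex_of_vec[unfolded complex_of_vec_def])

lemma bounded_linear_vec_of_complex: "bounded_linear vec_of_complex"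
proof (rule bounded_linear_intro[of _ 1])
  show "norm (vec_of_complex z) \<le> norm z * 1" for z
    using norm_complex_of_vec[of "vec_of_complex z"] by simp
qed (auto simp: vec_of_complex_def vec_eq_iff forall_2)

lemma complex_of_vec_eq_0_iff [simp]: "complex_of_vec v = 0 \<longleftrightarrow> v = 0"
  by (metis norm_complex_of_vec norm_eq_zero)

lemma complex_of_vec_scaleR: "complex_of_vec (t *\<^sub>R v) = of_real t * complex_of_vec v"
  by (simp add: complex_of_vec_def complex_eq_iff)

lemma vec_of_complex_of_real_mult: "vec_of_complex (of_real t * z) = t *\<^sub>R vec_of_complex z"
  by (simp add: vec_of_complex_def vec_eq_iff forall_2)

text \<open>The coefficients are the Wirtinger derivatives of the linear map. The determinant
  identity turns the sign of the Jacobian into the comparison of moduli in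
  \<open>simple_zero_derivative\<close>.\<close>

lemma matrix_2_complex:
  fixes A :: "real^2^2"
  obtains \<alpha> \<beta> where "\<And>h. complex_of_vec (A *v vec_of_complex h) = \<alpha> * h + \<beta> * cnj h"
    and "(norm \<alpha>)\<^sup>2 - (norm \<beta>)\<^sup>2 = det A"
proof
  show "complex_of_vec (A *v vec_of_complex h) =
      Complex ((A$1$1 + A$2$2) / 2) ((A$2$1 - A$1$2) / 2) * h +
      Complex ((A$1$1 - A$2$2) / 2) ((A$2$1 + A$1$2) / 2) * cnj h" for h
    by (simp add: complex_of_vec_def vec_of_complex_def complex_eq_iff matrix_vector_mult_def sum_2 field_simps)
  show "(norm (Complex ((A$1$1 + A$2$2) / 2) ((A$2$1 - A$1$2) / 2)))\<^sup>2 -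
      (norm (Complex ((A$1$1 - A$2$2) / 2) ((A$2$1 + A$1$2) / 2)))\<^sup>2 = det A"
    unfolding cmod_power2 det_2 by (simp add: power2_eq_square field_simps)
qed

text \<open>The choice operator returns the count of some regular approximation, possibly another
  than the given one. The count is an integer because every sign is.\<close>

lemma brouwer_degree_regular_approximation:
  assumes "regular_approximation f \<Omega> y g J"
  obtains g J where "regular_approximation f \<Omega> y g J"
    "real_of_int (brouwer_degree f \<Omega> y) = (\<Sum>x\<in>{x\<in>\<Omega>. g x = y}. sgn (det (J x)))"
proof -
  have "real_of_int (\<Sum>x\<in>{x\<in>\<Omega>. g x = y}. \<lfloor>sgn (det (J x))\<rfloor>) = (\<Sum>x\<in>{x\<in>\<Omega>. g x = y}. sgn (det (J x)))"
    by (simp add: sgn_if)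
  then have "\<exists>d g J. regular_approximation f \<Omega> y g J \<and>
      real_of_int d = (\<Sum>x\<in>{x\<in>\<Omega>. g x = y}. sgn (det (J x)))"
    using assms by blast
  from someI_ex[OF this, folded brouwer_degree_def] show ?thesis
    using that by blast
qed

text \<open>By homogeneity, a point of level \<open>\<rho>\<close> moves inside when shrunk slightly
  and outside when stretched slightly.\<close>

lemma norm_sublevel_set:
  fixes N :: "'a::real_normed_vector \<Rightarrow> real"
  assumes N: "\<And>t v. N (t *\<^sub>R v) = \<bar>t\<bar> * N v" "continuous_on UNIV N" "0 < \<rho>"
  shows "open {v. N v < \<rho>}" "closed {v. N v \<le> \<rho>}"
    and "closure {v. N v < \<rho>} = {v. N v \<le> \<rho>}" "interior {v. N v \<le> \<rho>} = {v. N v < \<rho>}"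
proof -
  show op: "open {v. N v < \<rho>}" and cl: "closed {v. N v \<le> \<rho>}"
    using N(2) by (auto intro!: open_Collect_less closed_Collect_le continuous_intros)
  have scale: "\<exists>d>0. dist ((1 + s * d) *\<^sub>R v) v < e \<and> 0 < 1 + s * d" if "0 < e" "\<bar>s\<bar> = 1" for e s :: real and v :: 'a
  proof -
    \<comment> \<open>The bound \<open>1/2\<close> keeps the factor positive for both signs
      \<open>s\<close>; the other bound keeps the displacement below \<open>e\<close>, also for
      \<open>v = 0\<close>.\<close>
    define d where "d = min (1/2) (e / (norm v + 1) / 2)"
    have "0 < norm v + 1"
      by (simp add: add_nonneg_pos)
    then have "0 < d"
      using \<open>0 < e\<close> by (auto simp: d_def)
    have "d \<le> e / (norm v + 1) / 2"
      by (simp add: d_def)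
    then have "d * (norm v + 1) \<le> e / 2"
      using \<open>0 < norm v + 1\<close> by (simp add: field_simps)
    then have "d * norm v < e"
      using \<open>0 < d\<close> \<open>0 < e\<close> by (simp add: algebra_simps)
    moreover have "dist ((1 + s * d) *\<^sub>R v) v = d * norm v"
      using that(2) \<open>0 < d\<close> by (simp add: dist_norm algebra_simps abs_mult)
    moreover have "d \<le> 1/2"
      unfolding d_def by (rule min.cobounded1)
    then have "0 < 1 + s * d"
      using that(2) \<open>0 < d\<close> by (auto simp: abs_if split: if_splits)
    ultimately show ?thesis
      using \<open>0 < d\<close> by auto
  qed
  show "closure {v. N v < \<rho>} = {v. N v \<le> \<rho>}"
  proof
    show "closure {v. N v < \<rho>} \<subseteq> {v. N v \<le> \<rho>}"
      by (rule closure_minimal[OF _ cl]) auto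
    show "{v. N v \<le> \<rho>} \<subseteq> closure {v. N v < \<rho>}"
    proof (clarsimp simp: closure_approachable)
      fix v e assume "N v \<le> \<rho>" "0 < (e::real)"
      obtain d where d: "0 < d" "dist ((1 + (- 1) * d) *\<^sub>R v) v < e" "0 < 1 + (- 1) * d"
        using scale[OF \<open>0 < e\<close>, of "- 1" v] by auto
      have "N ((1 + (- 1) * d) *\<^sub>R v) = (1 + (- 1) * d) * N v"
        using d(3) by (simp add: N(1))
      also have "\<dots> \<le> (1 + (- 1) * d) * \<rho>"
        using d(3) \<open>N v \<le> \<rho>\<close> by (intro mult_left_mono) auto
      also have "\<dots> < \<rho>"
        using d(1) N(3) by (simp add: algebra_simps)
      finally show "\<exists>y. N y < \<rho> \<and> dist y v < e"
        using d(2) by blast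
    qed
  qed
  show "interior {v. N v \<le> \<rho>} = {v. N v < \<rho>}"
  proof
    show "{v. N v < \<rho>} \<subseteq> interior {v. N v \<le> \<rho>}"
      by (rule interior_maximal[OF _ op]) auto
    show "interior {v. N v \<le> \<rho>} \<subseteq> {v. N v < \<rho>}"
    proof
      fix v assume v: "v \<in> interior {v. N v \<le> \<rho>}"
      then obtain e where "0 < e" and e: "ball v e \<subseteq> {v. N v \<le> \<rho>}"
        by (auto simp: mem_interior)
      obtain d where d: "0 < d" "dist ((1 + 1 * d) *\<^sub>R v) v < e"
        using scale[OF \<open>0 < e\<close>, of 1 v] by auto
      have "N ((1 + 1 * d) *\<^sub>R v) \<le> \<rho>"
        using d(2) e by (auto simp: dist_commute)
      then have "(1 + d) * N v \<le> \<rho>"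
        using d(1) by (simp add: N(1))
      then have "N v \<noteq> \<rho>"
        using mult_pos_pos[OF d(1) N(3)] by (auto simp: algebra_simps)
      then show "v \<in> {v. N v < \<rho>}"
        using v interior_subset[of "{v. N v \<le> \<rho>}"] by auto
    qed
  qed
qed

text \<open>Off the ray, \<open>f\<close> has a continuous logarithm on the boundary, and so has
  every regular approximation \<open>g\<close>, whose distance to \<open>f\<close> is there less
  than the modulus of \<open>f\<close>. The signs of the zeros of \<open>g\<close> thus cancel,
  whichever \<open>g\<close> realises the degree.\<close>

lemma brouwer_degree_eq_0_if_avoids_ray:
  fixes f :: "real^2 \<Rightarrow> real^2" and N :: "real^2 \<Rightarrow> real"
  assumes N_add: "\<And>v w. N (v + w) \<le> N v + N w" and N_scale: "\<And>t v. N (t *\<^sub>R v) = \<bar>t\<bar> * N v"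
    and N_pos: "\<And>v. v \<noteq> 0 \<Longrightarrow> 0 < N v" and N_cont: "continuous_on UNIV N" and "0 < \<rho>"
    and f: "continuous_on {v. N v \<le> \<rho>} f"
    and "e \<noteq> 0" and ray: "\<And>v t. N v = \<rho> \<Longrightarrow> 0 \<le> t \<Longrightarrow> f v \<noteq> t *\<^sub>R e"
  shows "brouwer_degree f {v. N v < \<rho>} 0 = 0"
proof -
  define \<Omega> where "\<Omega> = {v. N v < \<rho>}"
  note level = norm_sublevel_set[OF N_scale N_cont \<open>0 < \<rho>\<close>, folded \<Omega>_def]
  have frontier: "frontier \<Omega> = {v. N v = \<rho>}"
    unfolding frontier_def level(3) interior_open[OF level(1)] by (auto simp: \<Omega>_def)
  have N_0: "N 0 = 0"
    using N_scale[of 0 0] by simp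
  have "axis 1 1 \<in> sphere (0 :: real^2) 1"
    by simp
  then have "sphere (0 :: real^2) 1 \<noteq> {}"
    by blast
  then obtain v0 where v0: "v0 \<in> sphere 0 1" "\<And>v. v \<in> sphere 0 1 \<Longrightarrow> N v0 \<le> N v"
    using continuous_attains_inf[OF compact_sphere _ continuous_on_subset[OF N_cont subset_UNIV]] by blast
  have "0 < N v0"
    using v0(1) by (intro N_pos) auto
  \<comment> \<open>The minimum \<open>N v0\<close> of \<open>N\<close> on the Euclidean unit sphere
    compares the two norms and bounds \<open>\<Omega>\<close>.\<close>
  have "norm v \<le> \<rho> / N v0" if "v \<in> \<Omega>" for v
  proof (cases "v = 0")
    case False
    then have "N v0 \<le> N ((1 / norm v) *\<^sub>R v)"
      by (intro v0(2)) simp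
    then have "N v0 * norm v \<le> N v"
      using False by (simp add: N_scale field_simps)
    then show ?thesis
      using that \<open>0 < N v0\<close> by (simp add: \<Omega>_def field_simps)
  qed (use \<open>0 < N v0\<close> \<open>0 < \<rho>\<close> in simp)
  then have "bounded \<Omega>"
    unfolding bounded_iff by blast
  have "0 \<in> \<Omega>"
    using N_0 \<open>0 < \<rho>\<close> by (simp add: \<Omega>_def)
  then have "\<Omega> \<noteq> {}" by blast
  have f_ne: "0 \<notin> f ` frontier \<Omega>"
    using ray[of _ 0] unfolding frontier by force
  have "continuous_on (closure \<Omega>) f"
    using f unfolding level(3) .
  then obtain g0 J0 where reg0: "regular_approximation f \<Omega> 0 g0 J0"
    by (rule regular_approximation_exists[OF \<open>bounded \<Omega>\<close> \<open>\<Omega> \<noteq> {}\<close> _ f_ne])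
  obtain g J where reg: "regular_approximation f \<Omega> 0 g J"
    and deg: "real_of_int (brouwer_degree f \<Omega> 0) = (\<Sum>x\<in>{x\<in>\<Omega>. g x = 0}. sgn (det (J x)))"
    by (rule brouwer_degree_regular_approximation[OF reg0])
  have g_cont: "continuous_on {v. N v \<le> \<rho>} g"
    and g_der: "\<And>x. x \<in> \<Omega> \<Longrightarrow> (g has_derivative (\<lambda>h. J x *v h)) (at x)"
    and g_reg: "\<And>x. x \<in> \<Omega> \<Longrightarrow> g x = 0 \<Longrightarrow> det (J x) \<noteq> 0"
    and g_close: "\<And>x. N x \<le> \<rho> \<Longrightarrow> dist (g x) (f x) < infdist 0 (f ` frontier \<Omega>)"
    using reg unfolding regular_approximation_def level(3) by auto
  have close: "norm (g v - f v) < norm (f v)" if "N v = \<rho>" for v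
  proof -
    have "infdist 0 (f ` frontier \<Omega>) \<le> dist 0 (f v)"
      using that by (intro infdist_le) (auto simp: frontier)
    then show ?thesis
      using g_close[of v] that by (simp add: dist_norm)
  qed
  have "(\<Sum>x\<in>{x\<in>\<Omega>. g x = 0}. sgn (det (J x))) = 0"
  \<comment> \<open>A sum over an infinite set has the default value 0, which leaves the finite
    case.\<close>
  proof (cases "finite {x\<in>\<Omega>. g x = 0}")
    case fin: True
    define S where "S = {z. N (vec_of_complex z) \<le> \<rho>}"
    define q where "q z = complex_of_vec (g (vec_of_complex z))" for z
    define Z where "Z = complex_of_vec ` {x\<in>\<Omega>. g x = 0}"
    have "\<exists>\<alpha> \<beta>. (\<forall>h. complex_of_vec (A *v vec_of_complex h) = \<alpha> * h + \<beta> * cnj h) \<and>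
        (norm \<alpha>)\<^sup>2 - (norm \<beta>)\<^sup>2 = det A" for A
      by (metis matrix_2_complex)
    then obtain \<alpha> \<beta> where \<alpha>\<beta>: "\<And>A h. complex_of_vec (A *v vec_of_complex h) = \<alpha> A * h + \<beta> A * cnj h"
      and det: "\<And>A. (norm (\<alpha> A))\<^sup>2 - (norm (\<beta> A))\<^sup>2 = det A"
      by metis
    have sgn_det: "sgn (det A) = (if norm (\<beta> A) < norm (\<alpha> A) then 1 else - 1)" if "det A \<noteq> 0" for A
    proof -
      have "norm (\<beta> A) < norm (\<alpha> A) \<longleftrightarrow> (norm (\<beta> A))\<^sup>2 < (norm (\<alpha> A))\<^sup>2"
        by (auto intro: power_strict_mono dest: power_less_imp_less_base)
      then have "norm (\<beta> A) < norm (\<alpha> A) \<longleftrightarrow> 0 < det A"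
        unfolding det[of A, symmetric] by simp
      then show ?thesis
        using that by (auto simp: sgn_if)
    qed
    define s where "s z \<longleftrightarrow> norm (\<beta> (J (vec_of_complex z))) < norm (\<alpha> (J (vec_of_complex z)))" for z
    \<comment> \<open>The minus sign turns the forbidden ray onto the branch cut of
      \<open>Ln\<close>; the first two terms form a logarithm of \<open>f\<close>, and the third
      corrects from \<open>f\<close> to \<open>q\<close> by a quotient in the right half
      plane.\<close>
    define l where "l z = Ln (- (complex_of_vec (f (vec_of_complex z)) / complex_of_vec e)) + Ln (- complex_of_vec e)
        + Ln (q z / complex_of_vec (f (vec_of_complex z)))" for z
    \<comment> \<open>The polar radius of the boundary of the ball in direction
      \<open>\<theta>\<close>.\<close>
    define R where "R \<theta> = \<rho> / N (vec_of_complex (cis \<theta>))" for \<theta>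
    have vec_cont [continuous_intros]: "continuous_on A (\<lambda>x. vec_of_complex (h x))" if "continuous_on A h"
      for A :: "'z::topological_space set" and h
      using that by (rule bounded_linear.continuous_on[OF bounded_linear_vec_of_complex])
    have cplx_cont [continuous_intros]: "continuous_on A (\<lambda>x. complex_of_vec (h x))" if "continuous_on A h"
      for A :: "'z::topological_space set" and h
      using that by (rule bounded_linear.continuous_on[OF bounded_linear_complex_of_vec])
    have scale: "N (vec_of_complex (t *\<^sub>R z)) = \<bar>t\<bar> * N (vec_of_complex z)" for t z
      unfolding scaleR_conv_of_real[where 'a = complex] vec_of_complex_of_real_mult N_scale ..
    have N_vec_cont: "continuous_on UNIV (\<lambda>z. N (vec_of_complex z))"
      by (intro continuous_on_compose2[OF N_cont] continuous_intros) auto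
    have interior_S: "interior S = {z. N (vec_of_complex z) < \<rho>}"
      unfolding S_def by (rule norm_sublevel_set(4)[OF scale N_vec_cont \<open>0 < \<rho>\<close>])
    then have bd: "z \<in> S - interior S \<longleftrightarrow> N (vec_of_complex z) = \<rho>" for z
      by (auto simp: S_def)
    have q_cont: "continuous_on S q"
      unfolding q_def S_def by (intro continuous_intros continuous_on_compose2[OF g_cont]) auto
    have f_cont: "continuous_on S (\<lambda>z. complex_of_vec (f (vec_of_complex z)))"
      unfolding S_def by (intro continuous_intros continuous_on_compose2[OF f]) auto
    have f_not_0: "complex_of_vec (f (vec_of_complex z)) \<noteq> 0" if "z \<in> S - interior S" for z
      using ray[of "vec_of_complex z" 0] that unfolding bd by simp
    have slit1: "- (complex_of_vec (f (vec_of_complex z)) / complex_of_vec e) \<notin> \<real>\<^sub>\<le>\<^sub>0" if "z \<in> S - interior S" for z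
    proof
      assume "- (complex_of_vec (f (vec_of_complex z)) / complex_of_vec e) \<in> \<real>\<^sub>\<le>\<^sub>0"
      then obtain t where "- (complex_of_vec (f (vec_of_complex z)) / complex_of_vec e) = of_real t" "t \<le> 0"
        by (rule nonpos_Reals_cases)
      then have "complex_of_vec (f (vec_of_complex z)) = complex_of_vec ((- t) *\<^sub>R e)"
        using \<open>e \<noteq> 0\<close> unfolding complex_of_vec_scaleR by (simp add: field_simps) (metis add.inverse_inverse)
      then have "f (vec_of_complex z) = (- t) *\<^sub>R e"
        by (metis vec_of_complex_of_vec)
      then show False
        using ray[of "vec_of_complex z" "- t"] that \<open>t \<le> 0\<close> unfolding bd by simp
    qed
    have Re_pos: "0 < Re (q z / complex_of_vec (f (vec_of_complex z)))" if z: "z \<in> S - interior S" for z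
    proof -
      have "q z - complex_of_vec (f (vec_of_complex z)) = complex_of_vec (g (vec_of_complex z) - f (vec_of_complex z))"
        by (simp add: q_def bounded_linear.linear[OF bounded_linear_complex_of_vec] linear_diff)
      then have "norm (q z - complex_of_vec (f (vec_of_complex z))) < norm (complex_of_vec (f (vec_of_complex z)))"
        using close[of "vec_of_complex z"] z unfolding bd by simp
      moreover have "q z / complex_of_vec (f (vec_of_complex z)) - 1 =
          (q z - complex_of_vec (f (vec_of_complex z))) / complex_of_vec (f (vec_of_complex z))"
        using f_not_0[OF z] by (simp only: diff_divide_distrib) simp
      ultimately have "norm (q z / complex_of_vec (f (vec_of_complex z)) - 1) < 1"
        using f_not_0[OF z] by (simp only: norm_divide) (simp add: divide_less_eq_1)
      then show ?thesis
        using abs_Re_le_cmod[of "q z / complex_of_vec (f (vec_of_complex z)) - 1"] by auto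
    qed
    have slit2: "q z / complex_of_vec (f (vec_of_complex z)) \<notin> \<real>\<^sub>\<le>\<^sub>0" if "z \<in> S - interior S" for z
      using Re_pos[OF that] by (auto simp: complex_nonpos_Reals_iff)
    have q_not_0: "q z \<noteq> 0" if "z \<in> S - interior S" for z
      using Re_pos[OF that] by auto
    have "(\<Sum>x\<in>Z. if s x then 1 else - 1 :: real) = 0"
    proof (rule sum_signs_simple_zeros_eq_0[where S = S and q = q and l = l and R = R])
      show "finite Z"
        using fin by (simp add: Z_def)
      show "Z \<subseteq> interior S"
        by (auto simp: Z_def interior_S \<Omega>_def)
      show "0 \<in> interior S"
        using N_0 \<open>0 < \<rho>\<close> scale[of 0 0] by (simp add: interior_S)
      show "convex S"
      proof (rule convexI)
        fix x y :: complex and a b :: real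
        assume xy: "x \<in> S" "y \<in> S" and ab: "0 \<le> a" "0 \<le> b" "a + b = 1"
        have "vec_of_complex (a *\<^sub>R x + b *\<^sub>R y) = vec_of_complex (a *\<^sub>R x) + vec_of_complex (b *\<^sub>R y)"
          by (rule linear_add[OF bounded_linear.linear[OF bounded_linear_vec_of_complex]])
        then have "N (vec_of_complex (a *\<^sub>R x + b *\<^sub>R y)) \<le> a * N (vec_of_complex x) + b * N (vec_of_complex y)"
          using N_add[of "vec_of_complex (a *\<^sub>R x)" "vec_of_complex (b *\<^sub>R y)"] ab by (simp add: scale)
        also have "\<dots> \<le> \<rho>"
          using xy ab by (intro convex_bound_le) (auto simp: S_def)
        finally show "a *\<^sub>R x + b *\<^sub>R y \<in> S"
          by (simp add: S_def)
      qed
      show "continuous_on S q"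
        by (rule q_cont)
      show "q z = 0 \<longleftrightarrow> z \<in> Z" if "z \<in> S" for z
      proof
        assume "q z = 0"
        then have "z \<in> interior S" "g (vec_of_complex z) = 0"
          using q_not_0[of z] that by (auto simp: q_def)
        then have "vec_of_complex z \<in> {x \<in> \<Omega>. g x = 0}"
          by (simp add: interior_S \<Omega>_def)
        then show "z \<in> Z"
          unfolding Z_def by (metis complex_of_vec_of_complex imageI)
      qed (auto simp: Z_def q_def)
      show "simple_zero q x (s x)" if "x \<in> Z" for x
        unfolding s_def
      proof (rule simple_zero_derivative[of _ _ _ _ "interior S"])
        obtain v where v: "v \<in> \<Omega>" "g v = 0" "x = complex_of_vec v"
          using \<open>x \<in> Z\<close> by (auto simp: Z_def)
        have "((\<lambda>z. g (vec_of_complex z)) has_derivative (\<lambda>h. J v *v vec_of_complex h)) (at x)"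
          using v has_derivative_compose[OF bounded_linear_imp_has_derivative[OF bounded_linear_vec_of_complex], of g] g_der[OF v(1)]
          by simp
        from bounded_linear.has_derivative[OF bounded_linear_complex_of_vec this]
        show "(q has_derivative (\<lambda>h. \<alpha> (J (vec_of_complex x)) * h + \<beta> (J (vec_of_complex x)) * cnj h)) (at x)"
          using v(3) by (simp add: \<alpha>\<beta> q_def[abs_def])
        show "q x = 0" "x \<in> interior S"
          using v by (auto simp: q_def interior_S \<Omega>_def)
        show "continuous_on (interior S) q"
          by (rule continuous_on_subset[OF q_cont interior_subset])
        show "norm (\<alpha> (J (vec_of_complex x))) \<noteq> norm (\<beta> (J (vec_of_complex x)))"
          using g_reg[OF v(1,2)] det[of "J v"] v(3) by auto
      qed simp
      show "continuous_on (S - interior S) l"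
        unfolding l_def using slit1 slit2 f_not_0 \<open>e \<noteq> 0\<close>
        by (intro continuous_intros continuous_on_subset[OF f_cont] continuous_on_subset[OF q_cont]) auto
      show "q z = exp (l z)" if "z \<in> S - interior S" for z
        using f_not_0[OF that] q_not_0[OF that] \<open>e \<noteq> 0\<close> by (simp add: l_def exp_add)
      have pos: "0 < N (vec_of_complex (cis \<theta>))" for \<theta>
      proof (rule N_pos)
        show "vec_of_complex (cis \<theta>) \<noteq> 0"
          by (metis complex_of_vec_eq_0_iff complex_of_vec_of_complex cis_neq_zero)
      qed
      show "continuous_on {0..2*pi} R"
        unfolding R_def using pos
        by (intro continuous_intros continuous_on_compose2[OF N_vec_cont]) (auto simp: less_imp_neq[THEN not_sym])
      show "0 < R \<theta>" for \<theta>
        using pos \<open>0 < \<rho>\<close> by (simp add: R_def)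
      show "R (2*pi) = R 0"
        by (simp add: R_def cis_2pi)
      show "complex_of_real (R \<theta>) * cis \<theta> \<in> S - interior S" for \<theta>
        unfolding bd using pos[of \<theta>] \<open>0 < \<rho>\<close>
        by (simp add: vec_of_complex_of_real_mult N_scale) (simp add: R_def)
    qed
    moreover have "(\<Sum>x\<in>Z. if s x then 1 else - 1 :: real) = (\<Sum>x\<in>{x\<in>\<Omega>. g x = 0}. sgn (det (J x)))"
      unfolding Z_def
    proof (subst sum.reindex)
      show "inj_on complex_of_vec {x\<in>\<Omega>. g x = 0}"
        by (rule inj_on_inverseI[of _ vec_of_complex]) simp
      show "sum ((\<lambda>x. if s x then 1 else - 1) \<circ> complex_of_vec) {x\<in>\<Omega>. g x = 0} = (\<Sum>x\<in>{x\<in>\<Omega>. g x = 0}. sgn (det (J x)))"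
        using g_reg by (intro sum.cong) (auto simp: s_def sgn_det)
    qed
    ultimately show ?thesis
      by simp
  qed simp
  then show ?thesis
    using deg by (simp add: \<Omega>_def)
qed

section \<open>The degree of \<open>G\<close>\<close>

lemma vector_2_eq: "vector [x, y] = (\<chi> i::2. if i = 1 then x else y)"
  by (simp add: vec_eq_iff forall_2)

text \<open>The modulus of an affine function is largest at an end point of the interval.\<close>

lemma affine_C1_norm_eq:
  assumes "0 < T"
  shows "affine_C1_norm T v = max \<bar>v$1\<bar> \<bar>v$1 + v$2 * T\<bar> + \<bar>v$2\<bar>"
proof -
  have le: "\<bar>v$1 + v$2 * t\<bar> \<le> max \<bar>v$1\<bar> \<bar>v$1 + v$2 * T\<bar>" if "t \<in> {0..T}" for t
  proof (cases "0 \<le> v$2")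
    case True
    then have "0 \<le> v$2 * t" "v$2 * t \<le> v$2 * T"
      using that by (auto intro: mult_left_mono)
    then show ?thesis by auto
  next
    case False
    then have "v$2 * t \<le> 0" "v$2 * T \<le> v$2 * t"
      using that by (auto intro: mult_left_mono_neg simp: mult_nonpos_nonneg)
    then show ?thesis by auto
  qed
  then have bdd: "bdd_above ((\<lambda>t. \<bar>v$1 + v$2 * t\<bar>) ` {0..T})"
    by (rule bdd_aboveI2)
  have "sup_norm T (\<lambda>t. v$1 + v$2 * t) = max \<bar>v$1\<bar> \<bar>v$1 + v$2 * T\<bar>"
    unfolding sup_norm_def
  proof (rule antisym)
    show "(SUP t\<in>{0..T}. \<bar>v$1 + v$2 * t\<bar>) \<le> max \<bar>v$1\<bar> \<bar>v$1 + v$2 * T\<bar>"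
      using \<open>0 < T\<close> by (intro cSUP_least le) auto
    show "max \<bar>v$1\<bar> \<bar>v$1 + v$2 * T\<bar> \<le> (SUP t\<in>{0..T}. \<bar>v$1 + v$2 * t\<bar>)"
      using \<open>0 < T\<close> cSUP_upper[OF _ bdd, of 0] cSUP_upper[OF _ bdd, of T] by simp
  qed
  then show ?thesis
    using \<open>0 < T\<close> by (simp add: affine_C1_norm_def C1_norm_def sup_norm_def)
qed

lemma G_map_1_eq:
  "G_map T \<phi> 1 f v = vector [- (integral {0..T} (\<lambda>t. f t (v$1 + v$2 * t) (v$2)) / T), v$2 - v$1]"
  by (simp add: G_map_def B_map_def)

lemma continuous_on_G_map_1:
  assumes f: "continuous_on ({0..T} \<times> UNIV \<times> UNIV) (\<lambda>(t, x, y). f t x y)"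
  shows "continuous_on UNIV (G_map T \<phi> 1 f)"
proof -
  have "continuous_on (UNIV \<times> cbox 0 T) (\<lambda>p::(real^2) \<times> real.
      (\<lambda>(t, x, y). f t x y) (snd p, fst p $ 1 + fst p $ 2 * snd p, fst p $ 2))"
    by (intro continuous_on_compose2[OF f] continuous_intros) auto
  then have int: "continuous_on UNIV (\<lambda>v::real^2. integral {0..T} (\<lambda>t. f t (v$1 + v$2 * t) (v$2)))"
    using integral_continuous_on_param[of UNIV 0 T "\<lambda>v t. f t (v$1 + v$2 * t) (v$2)"]
    by (simp add: case_prod_unfold)
  have "continuous_on UNIV (\<lambda>v::real^2. - (integral {0..T} (\<lambda>t. f t (v$1 + v$2 * t) (v$2)) / T))"
    unfolding divide_inverse by (intro continuous_intros int)
  then have "continuous_on UNIV (\<lambda>v::real^2. if i = 1 then - (integral {0..T} (\<lambda>t. f t (v$1 + v$2 * t) (v$2)) / T)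
      else v$2 - v$1)" for i :: 2
    by (cases "i = 1") (auto intro!: continuous_intros)
  then show ?thesis
    unfolding G_map_1_eq[abs_def] vector_2_eq by (rule continuous_on_vec_lambda)
qed

text \<open>
  The second component of \<open>G\<close> only vanishes for \<open>x = y\<close>, so on the boundary \<open>G\<close> reaches the first
  axis only at \<open>\<plusminus>(a, a)\<close>, where \<open>a = \<rho> / (2 + T)\<close>.
\<close>

lemma sign_change_if_brouwer_degree_nonzero:
  fixes a \<rho> T :: real and f :: "real \<Rightarrow> real \<Rightarrow> real \<Rightarrow> real"
  assumes "T > 0" "a > 0" and \<rho>: "\<rho> = a * (2 + T)"
    and f: "continuous_on ({0..T} \<times> UNIV \<times> UNIV) (\<lambda>(t, x, y). f t x y)"
    and ne: "\<And>v. affine_C1_norm T v = \<rho> \<Longrightarrow> G_map T \<phi> 1 f v \<noteq> 0"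
    and deg: "brouwer_degree (G_map T \<phi> 1 f) {v. affine_C1_norm T v < \<rho>} 0 \<noteq> 0"
  shows "integral {0..T} (\<lambda>t. f t (a + a * t) a) * integral {0..T} (\<lambda>t. f t (- a + - a * t) (- a)) < 0"
proof (rule ccontr)
  define H where "H b = integral {0..T} (\<lambda>t. f t (b + b * t) b)" for b
  assume "\<not> ?thesis"
  then have nonneg: "0 \<le> H a * H (- a)"
    by (simp add: H_def)
  note N = affine_C1_norm_eq[OF \<open>T > 0\<close>]
  have N_diag: "affine_C1_norm T v = \<bar>v$1\<bar> * (2 + T)" if "v$2 = v$1" for v
  proof -
    have "v$1 + v$1 * T = v$1 * (1 + T)"
      by (simp add: algebra_simps)
    then have "\<bar>v$1 + v$1 * T\<bar> = \<bar>v$1\<bar> * (1 + T)"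
      using \<open>T > 0\<close> by (simp add: abs_mult)
    moreover have "\<bar>v$1\<bar> \<le> \<bar>v$1\<bar> * (1 + T)"
      using \<open>T > 0\<close> by (simp add: algebra_simps)
    ultimately show ?thesis
      by (simp add: N that algebra_simps)
  qed
  \<comment> \<open>The point \<open>(b, b)\<close> lies on the boundary, where \<open>G\<close> has
    no zero, and the second component of \<open>G\<close> vanishes there.\<close>
  have H_ne: "H b \<noteq> 0" if "\<bar>b\<bar> = a" for b
  proof
    assume "H b = 0"
    then have "G_map T \<phi> 1 f (vector [b, b]) = 0"
      by (simp add: G_map_1_eq H_def vec_eq_iff forall_2)
    then show False
      using ne[of "vector [b, b]"] that by (simp add: N_diag \<rho>)
  qed
  then have "H a \<noteq> 0" "H (- a) \<noteq> 0"
    using \<open>a > 0\<close> by auto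
  then have sgn_H: "sgn (H b) = sgn (H a)" if "\<bar>b\<bar> = a" for b
    using nonneg that by (auto simp: sgn_if abs_if zero_le_mult_iff split: if_splits)
  \<comment> \<open>With equal signs of \<open>H\<close>, the first component of \<open>G\<close> at
    both diagonal boundary points has the sign opposite to \<open>sgn (H a)\<close>, so the ray
    through \<open>e\<close> is missed.\<close>
  define e :: "real^2" where "e = vector [sgn (H a), 0]"
  have "brouwer_degree (G_map T \<phi> 1 f) {v. affine_C1_norm T v < \<rho>} 0 = 0"
  proof (rule brouwer_degree_eq_0_if_avoids_ray[where e = e])
    show "affine_C1_norm T (v + w) \<le> affine_C1_norm T v + affine_C1_norm T w" for v w
    proof -
      have eq: "v$1 + w$1 + (v$2 + w$2) * T = v$1 + v$2 * T + (w$1 + w$2 * T)"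
        by (simp add: algebra_simps)
      have "max \<bar>v$1 + w$1\<bar> \<bar>v$1 + w$1 + (v$2 + w$2) * T\<bar> \<le>
          max \<bar>v$1\<bar> \<bar>v$1 + v$2 * T\<bar> + max \<bar>w$1\<bar> \<bar>w$1 + w$2 * T\<bar>"
        unfolding eq
        by (intro max.boundedI; rule order_trans[OF abs_triangle_ineq])
          (intro add_mono max.cobounded1 max.cobounded2)+
      then show ?thesis
        unfolding N vector_add_component using abs_triangle_ineq[of "v$2" "w$2"] by linarith
    qed
    show "affine_C1_norm T (t *\<^sub>R v) = \<bar>t\<bar> * affine_C1_norm T v" for t v
    proof -
      have "\<bar>t * v$1 + t * v$2 * T\<bar> = \<bar>t\<bar> * \<bar>v$1 + v$2 * T\<bar>"
        by (simp add: algebra_simps flip: abs_mult)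
      then show ?thesis
        unfolding N by (simp add: abs_mult distrib_left max_mult_distrib_left)
    qed
    show "0 < affine_C1_norm T v" if "v \<noteq> 0" for v
    proof -
      have "v$1 \<noteq> 0 \<or> v$2 \<noteq> 0"
        using that by (auto simp: vec_eq_iff forall_2)
      then show ?thesis
        unfolding N by auto
    qed
    show "continuous_on UNIV (affine_C1_norm T)"
      unfolding N[abs_def] by (intro continuous_intros)
    show "0 < \<rho>"
      using \<open>a > 0\<close> \<open>T > 0\<close> by (simp add: \<rho>)
    show "continuous_on {v. affine_C1_norm T v \<le> \<rho>} (G_map T \<phi> 1 f)"
      by (rule continuous_on_subset[OF continuous_on_G_map_1[OF f] subset_UNIV])
    show "e \<noteq> 0"
      using \<open>H a \<noteq> 0\<close> by (simp add: e_def vec_eq_iff forall_2 sgn_0_0)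
    show "G_map T \<phi> 1 f v \<noteq> t *\<^sub>R e" if v: "affine_C1_norm T v = \<rho>" and "0 \<le> t" for v t
    proof
      assume "G_map T \<phi> 1 f v = t *\<^sub>R e"
      then have v_eq: "v$2 = v$1" and H_eq: "- (integral {0..T} (\<lambda>t. f t (v$1 + v$2 * t) (v$2)) / T) = t * sgn (H a)"
        by (auto simp: G_map_1_eq e_def vec_eq_iff forall_2)
      have "\<bar>v$1\<bar> = a"
        using v \<open>T > 0\<close> by (simp add: N_diag[OF v_eq] \<rho>)
      have "- (H (v$1) / T) = t * sgn (H a)"
        using H_eq by (simp add: v_eq H_def)
      then have "- (H (v$1) / T) = t * sgn (H (v$1))"
        by (simp add: sgn_H[OF \<open>\<bar>v$1\<bar> = a\<close>])
      then have "\<bar>H (v$1)\<bar> = - (t * T)"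
        using \<open>T > 0\<close> H_ne[OF \<open>\<bar>v$1\<bar> = a\<close>] by (auto simp: sgn_if field_simps split: if_splits)
      then show False
        using mult_nonneg_nonneg[OF \<open>0 \<le> t\<close> less_imp_le[OF \<open>T > 0\<close>]] H_ne[OF \<open>\<bar>v$1\<bar> = a\<close>] by simp
    qed
  qed
  then show False
    using deg by blast
qed

section \<open>Choice of the amplitude and existence of a solution\<close>

theorem theorem4p5:
  fixes T M\<^sub>1 M\<^sub>2 L r \<rho> :: real
    and \<phi> c :: "real \<Rightarrow> real"
    and f :: "real \<Rightarrow> real \<Rightarrow> real \<Rightarrow> real"
  assumes "T > 0"
    and "homeomorphism UNIV UNIV \<phi> (inv \<phi>)" and "\<phi> 0 = 0"
    and "continuous_on ({0..T} \<times> UNIV \<times> UNIV) (\<lambda>(t, x, y). f t x y)"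
    and "continuous_on {0..T} c"
    and "\<And>t x y. t \<in> {0..T} \<Longrightarrow> f t x y \<ge> c t"
    and "M\<^sub>1 < M\<^sub>2"
    and "\<And>u u'. C1_with_deriv T u u' \<Longrightarrow> (INF t\<in>{0..T}. u' t) \<ge> M\<^sub>2 \<Longrightarrow>
           integral {0..T} (\<lambda>t. f t (u t) (u' t)) \<noteq> 0"
    and "\<And>u u'. C1_with_deriv T u u' \<Longrightarrow> (SUP t\<in>{0..T}. u' t) \<le> M\<^sub>1 \<Longrightarrow>
           integral {0..T} (\<lambda>t. f t (u t) (u' t)) \<noteq> 0"
    and "L = max \<bar>\<phi> M\<^sub>2\<bar> \<bar>\<phi> M\<^sub>1\<bar>"
    and "r = max \<bar>inv \<phi> (L + 2 * L1_norm T (\<lambda>t. neg_part (c t)))\<bar>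
                 \<bar>inv \<phi> (- L - 2 * L1_norm T (\<lambda>t. neg_part (c t)))\<bar>"
    and "\<rho> \<ge> r * (2 + T)"
    and "\<And>v. affine_C1_norm T v = \<rho> \<Longrightarrow> G_map T \<phi> 1 f v \<noteq> 0"
    and "brouwer_degree (G_map T \<phi> 1 f) {v. affine_C1_norm T v < \<rho>} 0 \<noteq> 0"
  shows "\<exists>u u'. solves_phi_ode T \<phi> f u u' \<and> u' 0 = u 0 \<and> u' T = u' 0"
proof -
  define A where "A = L + 2 * L1_norm T (\<lambda>t. neg_part (c t))"
  \<comment> \<open>The affine function \<open>a + a t\<close> has norm
    \<open>a * (1 + T) + a\<close>, which equals \<open>\<rho>\<close> for this choice.\<close>
  define a where "a = \<rho> / (2 + T)"
  have \<psi>: "continuous_on UNIV (inv \<phi>)" and \<psi>\<phi>: "\<And>x. inv \<phi> (\<phi> x) = x" and \<phi>\<psi>: "\<And>x. \<phi> (inv \<phi> x) = x"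
    using \<open>homeomorphism UNIV UNIV \<phi> (inv \<phi>)\<close> by (auto simp: homeomorphism_def)
  have r: "r = max \<bar>inv \<phi> A\<bar> \<bar>inv \<phi> (- A)\<bar>"
    using assms(11) by (simp add: A_def)
  \<comment> \<open>Applied to \<open>M\<^sub>1\<close> and \<open>M\<^sub>2\<close>, this places
    both in \<open>[-a, a]\<close>, as the a priori bound requires.\<close>
  have r_bound: "\<bar>x\<bar> \<le> r" if "\<bar>\<phi> x\<bar> \<le> L" for x
  proof (cases "\<bar>\<phi> x\<bar> < A")
    case True
    then show ?thesis
      using abs_less_max_endpoints[OF \<psi> injI, of "- A" "\<phi> x" A] \<phi>\<psi> \<psi>\<phi> unfolding r by (smt (verit))
  next
    case False
    \<comment> \<open>Here \<open>A = L\<close>, which happens if the negative part of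
      \<open>c\<close> has norm 0, and the strict comparison with the end points is replaced by
      equality.\<close>
    then have "\<phi> x = A \<or> \<phi> x = - A"
      using that L1_norm_nonneg[of T "\<lambda>t. neg_part (c t)"] unfolding A_def by linarith
    then show ?thesis
      unfolding r by (metis \<psi>\<phi> max.cobounded1 max.cobounded2)
  qed
  then have M: "\<bar>M\<^sub>1\<bar> \<le> r" "\<bar>M\<^sub>2\<bar> \<le> r"
    by (auto simp: assms(10))
  have "r \<le> a"
    using \<open>T > 0\<close> \<open>\<rho> \<ge> r * (2 + T)\<close> by (simp add: a_def field_simps)
  then have M_a: "- a \<le> M\<^sub>1" "M\<^sub>2 \<le> a" and "a > 0"
    using M \<open>M\<^sub>1 < M\<^sub>2\<close> by linarith+
  have "\<rho> = a * (2 + T)"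
    using \<open>T > 0\<close> by (simp add: a_def)
  have sign: "integral {0..T} (\<lambda>t. f t (a + a * t) a) * integral {0..T} (\<lambda>t. f t (- a + - a * t) (- a)) < 0"
    by (rule sign_change_if_brouwer_degree_nonzero[OF \<open>T > 0\<close> \<open>a > 0\<close> \<open>\<rho> = a * (2 + T)\<close> assms(4,13,14)])
  show ?thesis
    by (rule phi_laplacian_solution[OF assms(1,2,4-6,8-11) M_a(1) assms(7) M_a(2) \<open>r \<le> a\<close> sign])
qed

end
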